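(* Let $\mathscr{L}H=L(H)\rtimes H$ be a halo product. Assume that there exists a finite subset $F\subset L(H)$ for which there exist infinitely many $h\in H$ such that $\langle F,hFh^{-1}\rangle\neq\langle F\rangle\ast\langle hFh^{-1}\rangle$ (i.e. the natural morphism from the free product $\langle F\rangle\ast\langle hFh^{-1}\rangle$ onto $\langle F,hFh^{-1}\rangle$ is not injective). Then $\mathscr{L}H$ is not finitely presented.
   Context: Halo products: let $H$ be a group. A halo of groups $\mathscr{L}$ over $H$ is the data, for every subset $S \subset H$, of a group $L(S)$ such that: (i) if $R \subset S \subset H$ then $L(R) \leq L(S)$; (ii) $L(\emptyset)=\{1\}$ and $L(H)=\langle L(S) : S \subset H \text{ finite}\rangle$; (iii) $L(R)\cap L(S)=L(R\cap S)$ for all $R,S\subset H$. Given a morphism $\alpha : H \to \mathrm{Aut}(L(H))$ with $\alpha(h)(L(S))=L(hS)$ for all $h\in H$, $S\subset H$, the halo product $\mathscr{L}H$ is the semidirect product $L(H)\rtimes_\alpha H$. Here $L(H)$ is not assumed to be locally finite. *)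

theory Defs
  imports "HOL-Algebra.Bij" "HOL-Algebra.Generated_Groups"
begin

section \<open>Groups given by words modulo a congruence\<close>

text \<open>The congruence on the free monoid \<open>lists A\<close> generated by the pairs in \<open>R\<close>.\<close>

inductive word_cong :: "'a set \<Rightarrow> ('a list \<times> 'a list) set \<Rightarrow> 'a list \<Rightarrow> 'a list \<Rightarrow> bool"
  for A R where
  word_refl: "w \<in> lists A \<Longrightarrow> word_cong A R w w"
| word_rule: "(u, v) \<in> R \<Longrightarrow> u \<in> lists A \<Longrightarrow> v \<in> lists A \<Longrightarrow> word_cong A R u v"
| word_sym: "word_cong A R u v \<Longrightarrow> word_cong A R v u"
| word_trans: "word_cong A R u v \<Longrightarrow> word_cong A R v w \<Longrightarrow> word_cong A R u w"
| word_append: "word_cong A R u u' \<Longrightarrow> word_cong A R v v' \<Longrightarrow> word_cong A R (u @ v) (u' @ v')"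

definition word_class :: "'a set \<Rightarrow> ('a list \<times> 'a list) set \<Rightarrow> 'a list \<Rightarrow> 'a list set" where
  "word_class A R w = {v. word_cong A R w v}"

definition word_monoid :: "'a set \<Rightarrow> ('a list \<times> 'a list) set \<Rightarrow> 'a list set monoid" where
  "word_monoid A R =
    \<lparr>carrier = word_class A R ` lists A,
     mult = (\<lambda>X Y. \<Union>u\<in>X. \<Union>v\<in>Y. word_class A R (u @ v)),
     one = word_class A R []\<rparr>"

text \<open>The free group on \<open>X\<close>: the letters \<open>(x, True)\<close> and \<open>(x, False)\<close> stand for \<open>x\<close> and its inverse.\<close>

definition free_group :: "'a set \<Rightarrow> ('a \<times> bool) list set monoid" where
  "free_group X = word_monoid (X \<times> UNIV) {([(x, b), (x, \<not> b)], []) | x b. x \<in> X}"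

text \<open>The free product of two groups: words in the disjoint union of the carriers, where products
  are evaluated inside either factor and both units are identified with the empty word.\<close>

definition free_product ::
  "('a, 'm) monoid_scheme \<Rightarrow> ('b, 'n) monoid_scheme \<Rightarrow> ('a + 'b) list set monoid" where
  "free_product G K = word_monoid (carrier G <+> carrier K)
     ({([Inl x, Inl y], [Inl (x \<otimes>\<^bsub>G\<^esub> y)]) | x y. x \<in> carrier G \<and> y \<in> carrier G}
      \<union> {([Inr x, Inr y], [Inr (x \<otimes>\<^bsub>K\<^esub> y)]) | x y. x \<in> carrier K \<and> y \<in> carrier K}
      \<union> {([Inl \<one>\<^bsub>G\<^esub>], []), ([Inr \<one>\<^bsub>K\<^esub>], [])})"

definition word_eval :: "('c, 'k) monoid_scheme \<Rightarrow> ('a \<Rightarrow> 'c) \<Rightarrow> 'a list \<Rightarrow> 'c" where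
  "word_eval G f w = foldr (\<lambda>x y. f x \<otimes>\<^bsub>G\<^esub> y) w \<one>\<^bsub>G\<^esub>"

text \<open>For subgroups \<open>A\<close>, \<open>B\<close> of \<open>G\<close>, the free product of \<open>A\<close> and \<open>B\<close> and the natural morphism
  from it to \<open>G\<close>, whose image is the subgroup generated by \<open>A \<union> B\<close>.\<close>

definition subgroup_free_product ::
  "('a, 'm) monoid_scheme \<Rightarrow> 'a set \<Rightarrow> 'a set \<Rightarrow> ('a + 'a) list set monoid" where
  "subgroup_free_product G A B = free_product (G\<lparr>carrier := A\<rparr>) (G\<lparr>carrier := B\<rparr>)"

definition natural_morphism :: "('a, 'm) monoid_scheme \<Rightarrow> ('a + 'a) list set \<Rightarrow> 'a" where
  "natural_morphism G X = the_elem (word_eval G (case_sum id id) ` X)"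


section \<open>Finite presentability\<close>

definition normal_closure :: "('a, 'm) monoid_scheme \<Rightarrow> 'a set \<Rightarrow> 'a set" where
  "normal_closure G R = generate G {g \<otimes>\<^bsub>G\<^esub> r \<otimes>\<^bsub>G\<^esub> inv\<^bsub>G\<^esub> g | g r. g \<in> carrier G \<and> r \<in> R}"

text \<open>Finite generating sets are taken, without loss of generality, to be initial segments of \<open>nat\<close>.\<close>

definition finitely_presented :: "('a, 'm) monoid_scheme \<Rightarrow> bool" where
  "finitely_presented G \<longleftrightarrow>
    (\<exists>(n::nat) R. finite R \<and> R \<subseteq> carrier (free_group {..<n}) \<and>
       (free_group {..<n} Mod normal_closure (free_group {..<n}) R) \<cong> G)"


section \<open>Halo products\<close>

text \<open>Since the operation of \<open>L R\<close> is a record component of its own, \<open>L R \<le> L S\<close> is expressed by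
  saying that the inclusion of carriers is a homomorphism.\<close>

locale halo = H?: group H for H :: "('h, 'm) monoid_scheme" (structure) +
  fixes L :: "'h set \<Rightarrow> ('l, 'n) monoid_scheme"
  assumes halo_group: "S \<subseteq> carrier H \<Longrightarrow> group (L S)"
    and halo_mono: "R \<subseteq> S \<Longrightarrow> S \<subseteq> carrier H \<Longrightarrow> (\<lambda>x. x) \<in> hom (L R) (L S)"
    and halo_empty: "carrier (L {}) = {\<one>\<^bsub>L {}\<^esub>}"
    and halo_generated:
      "carrier (L (carrier H)) =
         generate (L (carrier H)) (\<Union>S \<in> {S. S \<subseteq> carrier H \<and> finite S}. carrier (L S))"
    and halo_Int: "R \<subseteq> carrier H \<Longrightarrow> S \<subseteq> carrier H \<Longrightarrow>
      carrier (L R) \<inter> carrier (L S) = carrier (L (R \<inter> S))"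

locale halo_action = halo H L
  for H :: "('h, 'm) monoid_scheme" (structure) and L :: "'h set \<Rightarrow> ('l, 'n) monoid_scheme" +
  fixes \<alpha> :: "'h \<Rightarrow> 'l \<Rightarrow> 'l"
  assumes action_hom: "\<alpha> \<in> hom H (AutoGroup (L (carrier H)))"
    and action_translate: "h \<in> carrier H \<Longrightarrow> S \<subseteq> carrier H \<Longrightarrow>
      \<alpha> h ` carrier (L S) = carrier (L (h <# S))"

definition semidirect_product ::
  "('l, 'n) monoid_scheme \<Rightarrow> ('h, 'm) monoid_scheme \<Rightarrow> ('h \<Rightarrow> 'l \<Rightarrow> 'l) \<Rightarrow> ('l \<times> 'h) monoid" where
  "semidirect_product N H \<alpha> =
    \<lparr>carrier = carrier N \<times> carrier H,
     mult = (\<lambda>(x, g) (y, h). (x \<otimes>\<^bsub>N\<^esub> \<alpha> g y, g \<otimes>\<^bsub>H\<^esub> h)),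
     one = (\<one>\<^bsub>N\<^esub>, \<one>\<^bsub>H\<^esub>)\<rparr>"

definition halo_product ::
  "('h, 'm) monoid_scheme \<Rightarrow> ('h set \<Rightarrow> ('l, 'n) monoid_scheme) \<Rightarrow> ('h \<Rightarrow> 'l \<Rightarrow> 'l) \<Rightarrow> ('l \<times> 'h) monoid"
  where "halo_product H L \<alpha> = semidirect_product (L (carrier H)) H \<alpha>"

definition conj_set :: "('a, 'm) monoid_scheme \<Rightarrow> 'a \<Rightarrow> 'a set \<Rightarrow> 'a set" where
  "conj_set G g X = (\<lambda>x. g \<otimes>\<^bsub>G\<^esub> x \<otimes>\<^bsub>G\<^esub> inv\<^bsub>G\<^esub> g) ` X"


section \<open>The constructions are well defined\<close>

lemma word_cong_lists: "word_cong A R u v \<Longrightarrow> u \<in> lists A \<and> v \<in> lists A"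
  by (induction rule: word_cong.induct) auto

lemma word_class_self: "w \<in> lists A \<Longrightarrow> w \<in> word_class A R w"
  by (simp add: word_class_def word_refl)

lemma word_class_eq: "word_cong A R u v \<Longrightarrow> word_class A R u = word_class A R v"
  unfolding word_class_def by (blast intro: word_sym word_trans)

lemma word_class_eq_iff:
  "u \<in> lists A \<Longrightarrow> word_class A R u = word_class A R v \<longleftrightarrow> word_cong A R u v"
  using word_class_eq word_class_self[of u A R] word_sym unfolding word_class_def by blast

lemma word_monoid_mult:
  assumes "u \<in> lists A" "v \<in> lists A"
  shows "word_class A R u \<otimes>\<^bsub>word_monoid A R\<^esub> word_class A R v = word_class A R (u @ v)"
proof -
  have "word_class A R (u' @ v') = word_class A R (u @ v)"
    if "u' \<in> word_class A R u" "v' \<in> word_class A R v" for u' v'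
    using that word_class_eq[OF word_append, of A R u u' v v'] by (simp add: word_class_def)
  then have "(\<Union>u'\<in>word_class A R u. \<Union>v'\<in>word_class A R v. word_class A R (u' @ v')) =
      word_class A R (u @ v)"
    using word_class_self[OF assms(1), of R] word_class_self[OF assms(2), of R] by blast
  then show ?thesis by (simp add: word_monoid_def)
qed

lemma monoid_word_monoid: "monoid (word_monoid A R)"
proof -
  have c: "carrier (word_monoid A R) = word_class A R ` lists A"
    and o: "\<one>\<^bsub>word_monoid A R\<^esub> = word_class A R []"
    by (simp_all add: word_monoid_def)
  show ?thesis
  proof (rule monoidI, goal_cases)
    case (1 X Y)
    then obtain u v where "X = word_class A R u" "u \<in> lists A" "Y = word_class A R v" "v \<in> lists A"
      unfolding c by blast
    then show ?case by (simp add: c word_monoid_mult del: in_lists_conv_set)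
  next
    case 2
    then show ?case by (simp add: c o)
  next
    case (3 X Y Z)
    then obtain u v w where "X = word_class A R u" "u \<in> lists A" "Y = word_class A R v" "v \<in> lists A"
      "Z = word_class A R w" "w \<in> lists A"
      unfolding c by blast
    then show ?case by (simp add: word_monoid_mult del: in_lists_conv_set)
  next
    case (4 X)
    then obtain u where "X = word_class A R u" "u \<in> lists A"
      unfolding c by blast
    then show ?case using word_monoid_mult[of "[]" A u R] by (simp add: o)
  next
    case (5 X)
    then obtain u where "X = word_class A R u" "u \<in> lists A"
      unfolding c by blast
    then show ?case using word_monoid_mult[of u A "[]" R] by (simp add: o)
  qed
qed

lemma group_word_monoid:
  assumes "\<And>a. a \<in> A \<Longrightarrow> \<exists>b\<in>A. word_cong A R [b, a] []"
  shows "group (word_monoid A R)"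
proof -
  interpret monoid "word_monoid A R" by (rule monoid_word_monoid)
  have c: "carrier (word_monoid A R) = word_class A R ` lists A"
    and o: "\<one>\<^bsub>word_monoid A R\<^esub> = word_class A R []"
    by (simp_all add: word_monoid_def)
  have ex: "\<exists>v\<in>lists A. word_cong A R (v @ w) []" if "w \<in> lists A" for w
    using that
  proof (induction w)
    case Nil
    then show ?case using word_refl[of "[]" A R] by (intro bexI[of _ "[]"]) simp_all
  next
    case (Cons a w)
    then obtain v where v: "v \<in> lists A" "word_cong A R (v @ w) []" by auto
    from Cons obtain b where b: "b \<in> A" "word_cong A R [b, a] []"
      using assms[of a] by blast
    have "word_cong A R ((v @ [b, a]) @ w) ((v @ []) @ w)"
      using v(1) b(2) Cons by (intro word_append word_refl) auto
    then have "word_cong A R ((v @ [b]) @ a # w) []"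
      using v(2) word_trans by fastforce
    moreover have "v @ [b] \<in> lists A" using v(1) b(1) by simp
    ultimately show ?case by blast
  qed
  show ?thesis
  proof (rule group_l_invI)
    fix X assume "X \<in> carrier (word_monoid A R)"
    then obtain w where w: "w \<in> lists A" "X = word_class A R w" by (auto simp: c)
    with ex obtain v where v: "v \<in> lists A" "word_cong A R (v @ w) []" by blast
    have "word_class A R v \<otimes>\<^bsub>word_monoid A R\<^esub> X = \<one>\<^bsub>word_monoid A R\<^esub>"
      using w v by (simp add: word_monoid_mult o word_class_eq)
    then show "\<exists>Y\<in>carrier (word_monoid A R). Y \<otimes>\<^bsub>word_monoid A R\<^esub> X = \<one>\<^bsub>word_monoid A R\<^esub>"
      using v c by blast
  qed
qed

lemma group_free_group: "group (free_group X)"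
  unfolding free_group_def
proof (rule group_word_monoid)
  fix a :: "'a \<times> bool" assume a: "a \<in> X \<times> UNIV"
  then obtain x b where "a = (x, b)" "x \<in> X" by auto
  then show "\<exists>c\<in>X \<times> UNIV.
      word_cong (X \<times> UNIV) {([(x, b), (x, \<not> b)], []) | x b. x \<in> X} [c, a] []"
    by (intro bexI[of _ "(x, \<not> b)"] word_rule) auto
qed

lemma group_free_product:
  assumes "group G" "group K"
  shows "group (free_product G K)"
proof -
  interpret G: group G by fact
  interpret K: group K by fact
  show ?thesis
    unfolding free_product_def
  proof (rule group_word_monoid)
    fix a assume "a \<in> carrier G <+> carrier K"
    then show "\<exists>b\<in>carrier G <+> carrier K. word_cong (carrier G <+> carrier K)
     ({([Inl x, Inl y], [Inl (x \<otimes>\<^bsub>G\<^esub> y)]) | x y. x \<in> carrier G \<and> y \<in> carrier G}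
      \<union> {([Inr x, Inr y], [Inr (x \<otimes>\<^bsub>K\<^esub> y)]) | x y. x \<in> carrier K \<and> y \<in> carrier K}
      \<union> {([Inl \<one>\<^bsub>G\<^esub>], []), ([Inr \<one>\<^bsub>K\<^esub>], [])}) [b, a] []" (is "\<exists>b\<in>?A. word_cong _ ?R _ _")
    proof
      fix x assume x: "a = Inl x" "x \<in> carrier G"
      have "([Inl (inv\<^bsub>G\<^esub> x), Inl x], [Inl (inv\<^bsub>G\<^esub> x \<otimes>\<^bsub>G\<^esub> x)]) \<in> ?R"
        using x G.inv_closed by blast
      then have "word_cong ?A ?R [Inl (inv\<^bsub>G\<^esub> x), a] [Inl \<one>\<^bsub>G\<^esub>]"
        using x by (intro word_rule) auto
      moreover have "word_cong ?A ?R [Inl \<one>\<^bsub>G\<^esub>] []" by (rule word_rule) auto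
      ultimately show ?thesis using x by (blast intro: word_trans G.inv_closed)
    next
      fix x assume x: "a = Inr x" "x \<in> carrier K"
      have "([Inr (inv\<^bsub>K\<^esub> x), Inr x], [Inr (inv\<^bsub>K\<^esub> x \<otimes>\<^bsub>K\<^esub> x)]) \<in> ?R"
        using x K.inv_closed by blast
      then have "word_cong ?A ?R [Inr (inv\<^bsub>K\<^esub> x), a] [Inr \<one>\<^bsub>K\<^esub>]"
        using x by (intro word_rule) auto
      moreover have "word_cong ?A ?R [Inr \<one>\<^bsub>K\<^esub>] []" by (rule word_rule) auto
      ultimately show ?thesis using x by (blast intro: word_trans K.inv_closed)
    qed
  qed
qed

context group
begin

lemma word_eval_closed: "f ` set w \<subseteq> carrier G \<Longrightarrow> word_eval G f w \<in> carrier G"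
  by (induction w) (auto simp: word_eval_def)

lemma word_eval_append:
  "f ` set u \<subseteq> carrier G \<Longrightarrow> f ` set v \<subseteq> carrier G \<Longrightarrow>
    word_eval G f (u @ v) = word_eval G f u \<otimes> word_eval G f v"
proof (induction u)
  case Nil
  then show ?case using word_eval_closed[of f v] by (simp add: word_eval_def)
next
  case (Cons a u)
  then show ?case
    using word_eval_closed[of f u] word_eval_closed[of f v] by (simp add: word_eval_def m_assoc)
qed

lemma word_eval_cong:
  assumes "word_cong A R u v" "f ` A \<subseteq> carrier G"
    and "\<And>u v. (u, v) \<in> R \<Longrightarrow> u \<in> lists A \<Longrightarrow> v \<in> lists A \<Longrightarrow> word_eval G f u = word_eval G f v"
  shows "word_eval G f u = word_eval G f v"
  using assms(1)
proof (induction rule: word_cong.induct)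
  case (word_rule u v)
  then show ?case by (rule assms(3))
next
  case (word_append u u' v v')
  have "f ` set w \<subseteq> carrier G" if "w \<in> lists A" for w
    using that assms(2) by auto
  then have "word_eval G f (x @ y) = word_eval G f x \<otimes> word_eval G f y"
    if "x \<in> lists A" "y \<in> lists A" for x y
    using that by (intro word_eval_append) blast+
  then show ?case
    using word_append word_cong_lists[OF word_append(1)] word_cong_lists[OF word_append(2)] by presburger
qed simp_all

lemma natural_morphism_class:
  assumes "subgroup A G" "subgroup B G" "w \<in> lists (A <+> B)"
  shows "\<exists>X \<in> carrier (subgroup_free_product G A B). w \<in> X \<and>
    natural_morphism G X = word_eval G (case_sum id id) w"
proof -
  note s = subgroup.mem_carrier[OF assms(1)] subgroup.mem_carrier[OF assms(2)]
  define R where "R =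
     {([Inl x, Inl y], [Inl (x \<otimes> y)]) | x y. x \<in> A \<and> y \<in> A}
      \<union> {([Inr x, Inr y], [Inr (x \<otimes> y)]) | x y. x \<in> B \<and> y \<in> B}
      \<union> {([Inl \<one>], []), ([Inr \<one>], [])}"
  have P: "subgroup_free_product G A B = word_monoid (A <+> B) R"
    by (simp add: subgroup_free_product_def free_product_def R_def)
  let ?X = "word_class (A <+> B) R w"
  have im: "case_sum id id ` (A <+> B) \<subseteq> carrier G" using s by auto
  have "word_eval G (case_sum id id) v = word_eval G (case_sum id id) w" if "v \<in> ?X" for v
  proof -
    have "word_cong (A <+> B) R w v" using that by (simp add: word_class_def)
    then have "word_eval G (case_sum id id) w = word_eval G (case_sum id id) v"
      by (rule word_eval_cong[OF _ im]) (auto simp: R_def word_eval_def s)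
    then show ?thesis by simp
  qed
  note unique = this
  have w: "w \<in> ?X" by (rule word_class_self[OF assms(3)])
  have "natural_morphism G ?X = word_eval G (case_sum id id) w"
    unfolding natural_morphism_def by (rule the_elem_image_unique) (use w unique in blast)+
  then show ?thesis
    using assms(3) w unfolding P word_monoid_def by (intro bexI[of _ ?X]) simp_all
qed

end

lemma group_semidirect_product:
  assumes "group N" "group H" "\<alpha> \<in> hom H (AutoGroup N)"
  shows "group (semidirect_product N H \<alpha>)"
proof -
  interpret N: group N by fact
  interpret H: group H by fact
  interpret A: group "AutoGroup N" by (rule N.AutoGroup)
  interpret \<alpha>: group_hom H "AutoGroup N" \<alpha>
    using assms(3) by unfold_locales
  have au: "\<alpha> g \<in> auto N" if "g \<in> carrier H" for g
    using \<alpha>.hom_closed[OF that] by (simp add: AutoGroup_def)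
  have cl: "\<alpha> g x \<in> carrier N" if "g \<in> carrier H" "x \<in> carrier N" for g x
    using au[OF that(1)] that(2) by (auto simp: auto_def hom_def)
  have mu: "\<alpha> g (x \<otimes>\<^bsub>N\<^esub> y) = \<alpha> g x \<otimes>\<^bsub>N\<^esub> \<alpha> g y"
    if "g \<in> carrier H" "x \<in> carrier N" "y \<in> carrier N" for g x y
    using au[OF that(1)] that by (auto simp: auto_def hom_def)
  have co: "\<alpha> (g \<otimes>\<^bsub>H\<^esub> h) x = \<alpha> g (\<alpha> h x)"
    if "g \<in> carrier H" "h \<in> carrier H" "x \<in> carrier N" for g h x
    using \<alpha>.hom_mult[OF that(1,2)] au[OF that(1)] au[OF that(2)] that(3)
    by (simp add: AutoGroup_def BijGroup_def auto_def compose_def)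
  have on: "\<alpha> \<one>\<^bsub>H\<^esub> x = x" if "x \<in> carrier N" for x
    using \<alpha>.hom_one that by (simp add: AutoGroup_def BijGroup_def)
  show ?thesis
  proof (rule groupI)
    fix p assume "p \<in> carrier (semidirect_product N H \<alpha>)"
    then obtain x h where p: "p = (x, h)" "x \<in> carrier N" "h \<in> carrier H"
      by (auto simp: semidirect_product_def)
    let ?q = "(\<alpha> (inv\<^bsub>H\<^esub> h) (inv\<^bsub>N\<^esub> x), inv\<^bsub>H\<^esub> h)"
    have "\<alpha> (inv\<^bsub>H\<^esub> h) (inv\<^bsub>N\<^esub> x) \<otimes>\<^bsub>N\<^esub> \<alpha> (inv\<^bsub>H\<^esub> h) x = \<alpha> (inv\<^bsub>H\<^esub> h) \<one>\<^bsub>N\<^esub>"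
      using p mu[of "inv\<^bsub>H\<^esub> h" "inv\<^bsub>N\<^esub> x" x, symmetric]
      by (simp del: \<alpha>.hom_inv)
    also have "\<dots> = \<one>\<^bsub>N\<^esub>"
      using mu[of "inv\<^bsub>H\<^esub> h" "\<one>\<^bsub>N\<^esub>" "\<one>\<^bsub>N\<^esub>"] cl[of "inv\<^bsub>H\<^esub> h" "\<one>\<^bsub>N\<^esub>"] p
      by (metis H.inv_closed N.l_cancel_one N.l_one N.one_closed)
    finally show "\<exists>q\<in>carrier (semidirect_product N H \<alpha>).
        q \<otimes>\<^bsub>semidirect_product N H \<alpha>\<^esub> p = \<one>\<^bsub>semidirect_product N H \<alpha>\<^esub>"
      using p cl by (intro bexI[of _ ?q]) (auto simp: semidirect_product_def simp del: \<alpha>.hom_inv)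
  qed (auto simp: semidirect_product_def cl mu co on N.m_assoc H.m_assoc
      simp del: \<alpha>.hom_mult \<alpha>.hom_one)
qed

end

theory Submission
  imports Defs
begin

text \<open>
  Write \<open>N = L(H)\<close> and \<open>P = N \<rtimes> H\<close>, and let \<open>F\<close> be a finite subset of \<open>N\<close>. If \<open>P\<close> is finitely
  presented, then \<open>\<langle>F\<rangle>\<close> and \<open>\<langle>hFh\<^sup>-\<^sup>1\<rangle>\<close> generate their free product for all but finitely many \<open>h\<close>.
  Two facts combine to give this.

  Finite presentability makes the relations of \<open>N\<close> local (\<open>finitely_presented_local_relations\<close>).
  A relator of \<open>P\<close>, read letter by letter from a point \<open>g\<close> of \<open>H\<close>, traces a word in \<open>N\<close>: its
  letter \<open>(l, k)\<close> contributes the translate of \<open>l\<close> by the current position and then moves the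
  position by \<open>k\<close>. There are finitely many relators, so these words live in \<open>L(gK)\<close> for one
  finite \<open>K \<subseteq> H\<close>. Hence a map \<open>\<theta>\<close> from elements of \<open>N\<close> to a group \<open>Q\<close> that is multiplicative on each
  \<open>L(gK)\<close> respects every relation between the translates of \<open>\<langle>F\<rangle>\<close>.

  Such maps are obtained by cutting \<open>H\<close> in two. Let \<open>U\<close> be the union of the translates \<open>gK\<close> that
  meet \<open>K\<close>, and \<open>V\<close> the union of the others. Every \<open>gK\<close> lies in \<open>U\<close> or in \<open>V\<close>, so the amalgamated
  product \<open>Q\<close> of \<open>L(U)\<close> and \<open>L(V)\<close> over \<open>L(U) \<inter> L(V)\<close> receives all the groups \<open>L(gK)\<close> compatibly.
  Since \<open>K \<inter> V = \<emptyset>\<close>, the intersection axiom of a halo gives \<open>L(K) \<inter> L(V) = L(\<emptyset>) = 1\<close>; in the same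
  way \<open>L(hK) \<inter> L(U) = 1\<close> whenever \<open>hK\<close> misses the finite set \<open>U\<close>, that is, for all but finitely many
  \<open>h\<close>. For these \<open>h\<close> a reduced word in \<open>\<langle>F\<rangle> \<subseteq> L(K)\<close> and \<open>\<langle>hFh\<^sup>-\<^sup>1\<rangle> \<subseteq> L(hK)\<close> alternates between elements of
  \<open>L(U)\<close> outside \<open>L(V)\<close> and elements of \<open>L(V)\<close> outside \<open>L(U)\<close>, so it is nontrivial in \<open>Q\<close> by the
  normal form theorem for amalgams (\<open>amalgam_alternating\<close>). By locality it is nontrivial in \<open>P\<close>.
\<close>

section \<open>Alternating words in amalgamated products\<close>

lemma word_eval_Nil [simp]: "word_eval G f [] = \<one>\<^bsub>G\<^esub>"
  and word_eval_Cons [simp]: "word_eval G f (x # w) = f x \<otimes>\<^bsub>G\<^esub> word_eval G f w"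
  by (simp_all add: word_eval_def)

definition alternating :: "'a set \<Rightarrow> 'a set \<Rightarrow> 'a list \<Rightarrow> bool" where
  "alternating A B xs \<longleftrightarrow>
    set xs \<subseteq> (A - B) \<union> (B - A) \<and> successively (\<lambda>x y. x \<in> A \<longleftrightarrow> y \<notin> A) xs"

lemma alternating_Nil [simp]: "alternating A B []"
  by (simp add: alternating_def)

lemma alternating_Cons:
  "alternating A B (x # xs) \<longleftrightarrow> x \<in> (A - B) \<union> (B - A) \<and> alternating A B xs \<and>
    (xs \<noteq> [] \<longrightarrow> (x \<in> A \<longleftrightarrow> hd xs \<notin> A))"
  by (auto simp: alternating_def successively_Cons)

text \<open>The amalgam of \<open>A\<close> and \<open>B\<close> over \<open>A \<inter> B\<close> is represented by permutations of the set of its normal forms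
(van der Waerden's argument). A normal form \<open>(c, [t\<^sub>1, \<dots>, t\<^sub>n])\<close> stands for the product \<open>c t\<^sub>1 \<cdots> t\<^sub>n\<close>
with \<open>c \<in> A \<inter> B\<close> and with chosen representatives \<open>t\<^sub>i\<close> of nontrivial right cosets of \<open>A \<inter> B\<close>, taken
alternately in \<open>A\<close> and in \<open>B\<close>.\<close>

locale subgroup_pair = group G for G (structure) +
  fixes A B
  assumes subgroup_A: "subgroup A G" and subgroup_B: "subgroup B G"
begin

definition coset_rep :: "'a \<Rightarrow> 'a" where
  "coset_rep x = (if x \<in> A \<inter> B then \<one> else (SOME y. y \<in> (A \<inter> B) #> x))"

definition normal_forms :: "('a \<times> 'a list) set" where
  "normal_forms = {(c, ys). c \<in> A \<inter> B \<and> alternating A B ys \<and> (\<forall>y\<in>set ys. coset_rep y = y)}"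

text \<open>For \<open>K = A\<close> or \<open>K = B\<close>, merging the head of a normal form with a first representative from \<open>K\<close> identifies
the normal forms with pairs of an element of \<open>K\<close> and a tail that does not begin in \<open>K\<close>. On such pairs
left multiplication by \<open>K\<close> is evidently an action, and \<open>act\<close> is this action transported back.\<close>

definition expanded_forms :: "'a set \<Rightarrow> ('a \<times> 'a list) set" where
  "expanded_forms K = {(x, ys). x \<in> K \<and> alternating A B ys \<and> (\<forall>y\<in>set ys. coset_rep y = y) \<and>
     (ys \<noteq> [] \<longrightarrow> hd ys \<notin> K)}"

definition expand :: "'a set \<Rightarrow> 'a \<times> 'a list \<Rightarrow> 'a \<times> 'a list" where
  "expand K = (\<lambda>(c, ys). if ys \<noteq> [] \<and> hd ys \<in> K then (c \<otimes> hd ys, tl ys) else (c, ys))"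

definition collapse :: "'a \<times> 'a list \<Rightarrow> 'a \<times> 'a list" where
  "collapse = (\<lambda>(x, ys). if x \<in> A \<inter> B then (x, ys) else (x \<otimes> inv (coset_rep x), coset_rep x # ys))"

definition act :: "'a set \<Rightarrow> 'a \<Rightarrow> 'a \<times> 'a list \<Rightarrow> 'a \<times> 'a list" where
  "act K g p = collapse (map_prod ((\<otimes>) g) id (expand K p))"

lemma subgroup_Int: "subgroup (A \<inter> B) G"
  using subgroup_A subgroup_B by (rule subgroups_Inter_pair)

lemmas Int_m_closed = subgroup.m_closed[OF subgroup_Int]
  and Int_inv_closed = subgroup.m_inv_closed[OF subgroup_Int]
  and Int_carrier = subgroup.mem_carrier[OF subgroup_Int]

lemma subgroup_either: "K = A \<or> K = B \<Longrightarrow> subgroup K G"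
  using subgroup_A subgroup_B by blast

lemma coset_rep_in:
  assumes K: "K = A \<or> K = B" and x: "x \<in> K" "x \<notin> A \<inter> B"
  shows "coset_rep x \<in> K" "coset_rep x \<notin> A \<inter> B" "x \<otimes> inv (coset_rep x) \<in> A \<inter> B"
proof -
  note KG = subgroup.mem_carrier[OF subgroup_either[OF K]]
  have xG: "x \<in> carrier G" using x(1) by (rule KG)
  have "x \<in> (A \<inter> B) #> x" using rcos_self[OF xG subgroup_Int] .
  then have "(SOME y. y \<in> (A \<inter> B) #> x) \<in> (A \<inter> B) #> x" by (rule someI)
  then have "coset_rep x \<in> (A \<inter> B) #> x"
    unfolding coset_rep_def if_not_P[OF x(2)] .
  then obtain c where c: "c \<in> A \<inter> B" "coset_rep x = c \<otimes> x"
    by (auto simp: r_coset_def)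
  have cG: "c \<in> carrier G" using c(1) by (rule Int_carrier)
  show "coset_rep x \<in> K" using c x K subgroup.m_closed[OF subgroup_either[OF K], of c x] by auto
  show "coset_rep x \<notin> A \<inter> B"
  proof
    assume "coset_rep x \<in> A \<inter> B"
    then have "inv c \<otimes> (c \<otimes> x) \<in> A \<inter> B"
      unfolding c(2) by (rule Int_m_closed[OF Int_inv_closed[OF c(1)]])
    then show False using x xG cG by (simp add: m_assoc[symmetric])
  qed
  have "x \<otimes> inv (coset_rep x) = inv c"
    using c(2) xG cG by (simp add: inv_mult_group m_assoc[symmetric])
  then show "x \<otimes> inv (coset_rep x) \<in> A \<inter> B"
    using Int_inv_closed[OF c(1)] by simp
qed

lemma Int_mult_iff:
  assumes "c \<in> A \<inter> B" "x \<in> carrier G"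
  shows "c \<otimes> x \<in> A \<inter> B \<longleftrightarrow> x \<in> A \<inter> B"
proof
  assume "c \<otimes> x \<in> A \<inter> B"
  then have "inv c \<otimes> (c \<otimes> x) \<in> A \<inter> B"
    by (rule Int_m_closed[OF Int_inv_closed[OF assms(1)]])
  moreover have "c \<in> carrier G" using assms(1) by (rule Int_carrier)
  ultimately show "x \<in> A \<inter> B" using assms by (simp add: m_assoc[symmetric])
next
  assume "x \<in> A \<inter> B" then show "c \<otimes> x \<in> A \<inter> B"
    by (rule Int_m_closed[OF assms(1)])
qed

lemma coset_rep_mult:
  assumes "c \<in> A \<inter> B" "x \<in> carrier G"
  shows "coset_rep (c \<otimes> x) = coset_rep x"
proof -
  have "c \<in> carrier G" using assms(1) by (rule Int_carrier)
  then have "(A \<inter> B) #> (c \<otimes> x) = (A \<inter> B) #> x"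
    using assms coset_mult_assoc[of "A \<inter> B" c x] subgroup.subset[OF subgroup_Int]
      coset_join2[OF _ subgroup_Int assms(1)] by simp
  then show ?thesis using Int_mult_iff[OF assms] by (simp add: coset_rep_def)
qed

lemma coset_rep_idem:
  assumes K: "K = A \<or> K = B" and x: "x \<in> K" "x \<notin> A \<inter> B"
  shows "coset_rep (coset_rep x) = coset_rep x"
proof -
  note r = coset_rep_in[OF assms]
  have G: "x \<in> carrier G" "coset_rep x \<in> carrier G"
    using x(1) r(1) subgroup.mem_carrier[OF subgroup_either[OF K]] by blast+
  have "coset_rep ((x \<otimes> inv (coset_rep x)) \<otimes> coset_rep x) = coset_rep (coset_rep x)"
    using r(3) G(2) by (rule coset_rep_mult)
  then show ?thesis using G by (simp add: m_assoc)
qed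

lemma expand_closed:
  assumes K: "K = A \<or> K = B" and p: "p \<in> normal_forms"
  shows "expand K p \<in> expanded_forms K"
proof -
  obtain c ys where [simp]: "p = (c, ys)" by fastforce
  from p have c: "c \<in> A \<inter> B" and a: "alternating A B ys" and r: "\<forall>y\<in>set ys. coset_rep y = y"
    by (auto simp: normal_forms_def)
  show ?thesis
  proof (cases "ys \<noteq> [] \<and> hd ys \<in> K")
    case True
    then obtain y zs where [simp]: "ys = y # zs" and y: "y \<in> K" by (cases ys) auto
    have "c \<otimes> y \<in> K" using c y K subgroup.m_closed[OF subgroup_either[OF K], of c y] by auto
    moreover have "zs \<noteq> [] \<longrightarrow> hd zs \<notin> K"
      using a y K by (cases zs) (auto simp: alternating_Cons)
    ultimately show ?thesis using a r y by (auto simp: expand_def expanded_forms_def alternating_Cons)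
  next
    case False
    then show ?thesis using c a r K by (auto simp: expand_def expanded_forms_def)
  qed
qed

lemma collapse_closed:
  assumes K: "K = A \<or> K = B" and q: "q \<in> expanded_forms K"
  shows "collapse q \<in> normal_forms"
proof -
  obtain x ys where [simp]: "q = (x, ys)" by fastforce
  from q have x: "x \<in> K" and a: "alternating A B ys" and r: "\<forall>y\<in>set ys. coset_rep y = y"
    and h: "ys \<noteq> [] \<longrightarrow> hd ys \<notin> K"
    by (auto simp: expanded_forms_def)
  show ?thesis
  proof (cases "x \<in> A \<inter> B")
    case True
    then show ?thesis using a r by (auto simp: collapse_def normal_forms_def)
  next
    case False
    note f = coset_rep_in[OF K x False]
    have "ys \<noteq> [] \<longrightarrow> (coset_rep x \<in> A \<longleftrightarrow> hd ys \<notin> A)"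
      using f(1,2) h K a by (cases ys) (auto simp: alternating_Cons)
    then have "alternating A B (coset_rep x # ys)"
      using f(1,2) a K by (auto simp: alternating_Cons)
    then show ?thesis using False f coset_rep_idem[OF K x False] r
      by (auto simp: collapse_def normal_forms_def)
  qed
qed

lemma collapse_expand:
  assumes K: "K = A \<or> K = B" and p: "p \<in> normal_forms"
  shows "collapse (expand K p) = p"
proof -
  obtain c ys where [simp]: "p = (c, ys)" by fastforce
  from p have c: "c \<in> A \<inter> B" and a: "alternating A B ys" and r: "\<forall>y\<in>set ys. coset_rep y = y"
    by (auto simp: normal_forms_def)
  show ?thesis
  proof (cases "ys \<noteq> [] \<and> hd ys \<in> K")
    case True
    then obtain y zs where [simp]: "ys = y # zs" and y: "y \<in> K" by (cases ys) auto
    have G: "y \<in> carrier G" "c \<in> carrier G"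
      using y c subgroup.mem_carrier[OF subgroup_either[OF K]] Int_carrier by blast+
    have "y \<notin> A \<inter> B" using a by (auto simp: alternating_Cons)
    then have "c \<otimes> y \<notin> A \<inter> B" using Int_mult_iff[OF c G(1)] by simp
    moreover have "coset_rep (c \<otimes> y) = y" using coset_rep_mult[OF c G(1)] r by simp
    ultimately show ?thesis using G y by (simp add: expand_def collapse_def m_assoc)
  next
    case False
    then show ?thesis using c by (auto simp: expand_def collapse_def)
  qed
qed

lemma expand_collapse:
  assumes K: "K = A \<or> K = B" and q: "q \<in> expanded_forms K"
  shows "expand K (collapse q) = q"
proof -
  obtain x ys where [simp]: "q = (x, ys)" by fastforce
  from q have x: "x \<in> K" and h: "ys \<noteq> [] \<longrightarrow> hd ys \<notin> K"
    by (auto simp: expanded_forms_def)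
  show ?thesis
  proof (cases "x \<in> A \<inter> B")
    case True
    then show ?thesis using h by (auto simp: collapse_def expand_def)
  next
    case False
    note f = coset_rep_in[OF K x False]
    have "x \<in> carrier G" "coset_rep x \<in> carrier G"
      using x f(1) subgroup.mem_carrier[OF subgroup_either[OF K]] by blast+
    moreover have "collapse q = (x \<otimes> inv (coset_rep x), coset_rep x # ys)"
      using False by (auto simp: collapse_def)
    ultimately show ?thesis using f(1) by (simp add: expand_def m_assoc)
  qed
qed

lemma expanded_forms_mult:
  assumes K: "K = A \<or> K = B" and g: "g \<in> K" and q: "q \<in> expanded_forms K"
  shows "map_prod ((\<otimes>) g) id q \<in> expanded_forms K"
  using q g subgroup.m_closed[OF subgroup_either[OF K]] by (auto simp: expanded_forms_def)

lemma act_closed: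
  assumes "K = A \<or> K = B" "g \<in> K" "p \<in> normal_forms"
  shows "act K g p \<in> normal_forms"
  unfolding act_def
  by (intro collapse_closed[OF assms(1)] expanded_forms_mult[OF assms(1,2)] expand_closed assms)

lemma act_mult:
  assumes K: "K = A \<or> K = B" and g: "g \<in> K" and h: "h \<in> K" and p: "p \<in> normal_forms"
  shows "act K (g \<otimes> h) p = act K g (act K h p)"
proof -
  let ?q = "expand K p"
  have q: "?q \<in> expanded_forms K" using K p by (rule expand_closed)
  have "expand K (act K h p) = map_prod ((\<otimes>) h) id ?q"
    unfolding act_def using expand_collapse[OF K expanded_forms_mult[OF K h q]] .
  moreover have "map_prod ((\<otimes>) (g \<otimes> h)) id ?q = map_prod ((\<otimes>) g) id (map_prod ((\<otimes>) h) id ?q)"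
    using q g h subgroup.mem_carrier[OF subgroup_either[OF K]]
    by (auto simp: expanded_forms_def m_assoc)
  ultimately show ?thesis by (simp add: act_def)
qed

lemma act_one:
  assumes K: "K = A \<or> K = B" and p: "p \<in> normal_forms"
  shows "act K \<one> p = p"
proof -
  have q: "expand K p \<in> expanded_forms K" using K p by (rule expand_closed)
  then have "map_prod ((\<otimes>) \<one>) id (expand K p) = expand K p"
    using subgroup.mem_carrier[OF subgroup_either[OF K]] by (auto simp: expanded_forms_def)
  then show ?thesis using collapse_expand[OF K p] by (simp add: act_def)
qed

text \<open>The two actions have to agree on \<open>A \<inter> B\<close>, so that together they form one action of the amalgam. This
holds because an element of \<open>A \<inter> B\<close> only changes the head, whichever representative comes next.\<close>

lemma act_Int:
  assumes K: "K = A \<or> K = B" and g: "g \<in> A \<inter> B" and p: "p \<in> normal_forms"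
  shows "act K g p = map_prod ((\<otimes>) g) id p"
proof -
  obtain c ys where [simp]: "p = (c, ys)" by fastforce
  from p have c: "c \<in> A \<inter> B" and ys: "alternating A B ys" "\<forall>y\<in>set ys. coset_rep y = y"
    by (auto simp: normal_forms_def)
  have G: "c \<in> carrier G" "g \<in> carrier G" using c g Int_carrier by blast+
  have gp: "(g \<otimes> c, ys) \<in> normal_forms"
    using c g ys subgroup.m_closed[OF subgroup_Int] by (simp add: normal_forms_def)
  have "map_prod ((\<otimes>) g) id (expand K p) = expand K (g \<otimes> c, ys)"
    using G subgroup.mem_carrier[OF subgroup_either[OF K]] by (auto simp: expand_def m_assoc)
  then show ?thesis using collapse_expand[OF K gp] by (simp add: act_def)
qed

definition perm :: "'a \<Rightarrow> 'a \<times> 'a list \<Rightarrow> 'a \<times> 'a list" where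
  "perm g = restrict (act (if g \<in> A then A else B) g) normal_forms"

lemma perm_eq:
  assumes K: "K = A \<or> K = B" and g: "g \<in> K" and p: "p \<in> normal_forms"
  shows "perm g p = act K g p"
  using K g p act_Int[of A g p] act_Int[of B g p] by (auto simp: perm_def)

lemma perm_hom:
  assumes K: "K = A \<or> K = B"
  shows "perm \<in> hom (G\<lparr>carrier := K\<rparr>) (BijGroup normal_forms)"
proof -
  note s = subgroup_either[OF K]
  have inverse: "perm g (perm h p) = p"
    if "g \<in> K" "h \<in> K" "g \<otimes> h = \<one>" "p \<in> normal_forms" for g h p
    using that act_mult[OF K that(1,2,4)] act_one[OF K that(4)] act_closed[OF K that(2,4)]
    by (simp add: perm_eq[OF K])
  have closed: "perm g p \<in> normal_forms" if "g \<in> K" "p \<in> normal_forms" for g p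
    using act_closed[OF K that] perm_eq[OF K that] by simp
  have bij: "perm g \<in> Bij normal_forms" if g: "g \<in> K" for g
  proof -
    have i: "inv g \<in> K" "g \<in> carrier G"
      using subgroup.m_inv_closed[OF s g] subgroup.mem_carrier[OF s g] by simp_all
    have "bij_betw (perm g) normal_forms normal_forms"
      by (rule bij_betw_byWitness[where f' = "perm (inv g)"])
        (use closed inverse i g in auto)
    then show ?thesis by (simp add: Bij_def perm_def)
  qed
  have "perm (g \<otimes> h) = compose normal_forms (perm g) (perm h)" if "g \<in> K" "h \<in> K" for g h
  proof (rule extensionalityI[of _ normal_forms])
    fix p assume p: "p \<in> normal_forms"
    have "g \<otimes> h \<in> K" using that subgroup.m_closed[OF s] by blast
    then show "perm (g \<otimes> h) p = compose normal_forms (perm g) (perm h) p"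
      using that p act_mult[OF K that p] act_closed[OF K that(2) p]
      by (simp add: perm_eq[OF K] compose_eq)
  qed (auto simp: perm_def compose_def)
  then show ?thesis using bij by (auto simp: hom_def BijGroup_def)
qed

lemma BijGroup_mult_apply:
  assumes "f \<in> carrier (BijGroup S)" "h \<in> carrier (BijGroup S)" "p \<in> S"
  shows "(f \<otimes>\<^bsub>BijGroup S\<^esub> h) p = f (h p)"
  using assms by (simp add: BijGroup_def compose_eq)

text \<open>A letter outside \<open>A \<inter> B\<close>, applied to a normal form that begins in the other subgroup, puts one more
representative in front. So an alternating word sends the empty normal form to a nonempty one.\<close>

lemma perm_alternating:
  assumes "alternating A B xs" "xs \<noteq> []"
  shows "word_eval (BijGroup normal_forms) perm xs \<noteq> \<one>\<^bsub>BijGroup normal_forms\<^esub>"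
proof -
  interpret S: group "BijGroup normal_forms" by (rule group_BijGroup)
  have start: "(\<one>, []) \<in> normal_forms"
    using subgroup.one_closed[OF subgroup_Int] by (simp add: normal_forms_def)
  have bij: "perm x \<in> carrier (BijGroup normal_forms)" if "x \<in> A \<or> x \<in> B" for x
    using that perm_hom[of A] perm_hom[of B] by (auto simp: hom_def)
  let ?e = "\<lambda>xs. word_eval (BijGroup normal_forms) perm xs (\<one>, [])"
  have "?e xs \<in> normal_forms \<and>
      (xs \<noteq> [] \<longrightarrow> snd (?e xs) \<noteq> [] \<and> (hd (snd (?e xs)) \<in> A \<longleftrightarrow> hd xs \<in> A))"
    if "alternating A B xs" for xs
    using that
  proof (induction xs)
    case Nil
    then show ?case using start by (simp add: BijGroup_def)
  next
    case (Cons x xs)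
    let ?p = "?e xs"
    obtain c ys where p: "?p = (c, ys)" by fastforce
    define K where "K = (if x \<in> A then A else B)"
    have x: "x \<in> (A - B) \<union> (B - A)" and xs: "alternating A B xs"
      and head: "xs \<noteq> [] \<longrightarrow> (x \<in> A \<longleftrightarrow> hd xs \<notin> A)"
      using Cons.prems by (simp_all add: alternating_Cons)
    have K: "K = A \<or> K = B" "x \<in> K" using x by (auto simp: K_def)
    have IH: "?p \<in> normal_forms" "xs \<noteq> [] \<longrightarrow> ys \<noteq> [] \<and> (hd ys \<in> A \<longleftrightarrow> hd xs \<in> A)"
      using Cons.IH[OF xs] by (simp_all add: p)
    have c: "c \<in> A \<inter> B" and ys: "alternating A B ys"
      using IH(1) unfolding p by (simp_all add: normal_forms_def)
    have ysK: "ys = [] \<or> hd ys \<notin> K"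
    proof (cases "xs = []")
      case True
      then show ?thesis using p by (simp add: BijGroup_def start)
    next
      case False
      then show ?thesis using IH(2) head x ys by (cases ys) (auto simp: K_def alternating_Cons)
    qed
    have W: "word_eval (BijGroup normal_forms) perm xs \<in> carrier (BijGroup normal_forms)"
      using xs bij by (intro S.word_eval_closed) (auto simp: alternating_def)
    have "?e (x # xs) = perm x ?p"
      unfolding word_eval_Cons by (rule BijGroup_mult_apply[OF _ W start]) (use x bij in blast)
    then have e: "?e (x # xs) = act K x (c, ys)"
      using perm_eq[OF K IH(1)] p by simp
    have G: "c \<in> carrier G" "x \<in> carrier G"
      using Int_carrier[OF c] subgroup.mem_carrier[OF subgroup_either[OF K(1)] K(2)] by simp_all
    have xc: "x \<otimes> c \<in> K" using c K subgroup.m_closed[OF subgroup_either[OF K(1)], of x c] by auto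
    have nxc: "x \<otimes> c \<notin> A \<inter> B"
    proof
      assume "x \<otimes> c \<in> A \<inter> B"
      then have "(x \<otimes> c) \<otimes> inv c \<in> A \<inter> B"
        by (rule Int_m_closed[OF _ Int_inv_closed[OF c]])
      then show False using G x by (simp add: m_assoc)
    qed
    have "act K x (c, ys) = ((x \<otimes> c) \<otimes> inv (coset_rep (x \<otimes> c)), coset_rep (x \<otimes> c) # ys)"
      using ysK nxc by (auto simp: act_def expand_def collapse_def)
    moreover have "coset_rep (x \<otimes> c) \<in> A \<longleftrightarrow> x \<in> A"
      using coset_rep_in[OF K(1) xc nxc] x by (auto simp: K_def split: if_splits)
    ultimately show ?case
      using e act_closed[OF K, of "(c, ys)"] IH(1) p by simp
  qed
  from this[OF assms(1)] have "snd (?e xs) \<noteq> []" using assms(2) by blast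
  then show ?thesis by (auto simp: BijGroup_def start)
qed

end

text \<open>The normal form theorem, in the form in which it is applied: some group receives \<open>A\<close> and \<open>B\<close>
compatibly and separates alternating words from the unit. A single function \<open>\<theta>\<close> for both subgroups
expresses that the two homomorphisms agree on \<open>A \<inter> B\<close>.\<close>

lemma amalgam_alternating:
  fixes G :: "('a, 'm) monoid_scheme" (structure)
  assumes "group G" "subgroup A G" "subgroup B G"
  obtains Q :: "('a \<times> 'a list \<Rightarrow> 'a \<times> 'a list) monoid" and \<theta> where
    "group Q" "\<theta> \<in> hom (G\<lparr>carrier := A\<rparr>) Q" "\<theta> \<in> hom (G\<lparr>carrier := B\<rparr>) Q"
    "\<And>xs. alternating A B xs \<Longrightarrow> xs \<noteq> [] \<Longrightarrow> word_eval Q \<theta> xs \<noteq> \<one>\<^bsub>Q\<^esub>"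
proof -
  interpret subgroup_pair G A B
    using assms by (simp add: subgroup_pair_def subgroup_pair_axioms_def)
  show thesis
    by (rule that[of "BijGroup normal_forms" perm])
      (simp_all add: group_BijGroup perm_hom perm_alternating)
qed

section \<open>Finite presentations as word congruences\<close>

lemma word_cong_mono:
  assumes "word_cong A R u v" "R \<subseteq> R'"
  shows "word_cong A R' u v"
  using assms(1)
  by (induction rule: word_cong.induct) (use assms(2) in \<open>blast intro: word_cong.intros\<close>)+

text \<open>A finitely presented group has a finite monoid presentation on finitely many letters, closed under
formal inverses: one adds the relations \<open>x x\<^sup>-\<^sup>1 = 1\<close> to representatives of the relators. In this form,
facts about all words that are trivial in the group follow by induction on the congruence. The letters
are kept apart from their values \<open>f\<close>, as different generators may have the same value.\<close>

lemma finitely_presented_word_cong: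
  assumes P: "group P" and fp: "finitely_presented P"
  obtains X :: "(nat \<times> bool) set" and R f where
    "finite X" "finite R" "R \<subseteq> lists X \<times> lists X" "f ` X \<subseteq> carrier P"
    "\<And>u v. (u, v) \<in> R \<Longrightarrow> word_eval P f u = word_eval P f v"
    "\<And>p. p \<in> carrier P \<Longrightarrow> \<exists>w\<in>lists X. word_eval P f w = p"
    "\<And>w. w \<in> lists X \<Longrightarrow> word_eval P f w = \<one>\<^bsub>P\<^esub> \<Longrightarrow> word_cong X R w []"
proof -
  interpret P: group P by (rule P)
  obtain n :: nat and S where S: "finite S" "S \<subseteq> carrier (free_group {..<n})"
    and iso: "(free_group {..<n} Mod normal_closure (free_group {..<n}) S) \<cong> P"
    using fp unfolding finitely_presented_def by blast
  define F where "F = free_group {..<n}"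
  define N where "N = normal_closure F S"
  define X where "X = {..<n} \<times> (UNIV :: bool set)"
  define R0 where "R0 = {([(x, b), (x, \<not> b)], [] :: (nat \<times> bool) list) | x b. x \<in> {..<n}}"
  interpret F: group F unfolding F_def by (rule group_free_group)
  have F: "F = word_monoid X R0" by (simp add: F_def free_group_def X_def R0_def)
  have carF: "carrier F = word_class X R0 ` lists X" and oneF: "\<one>\<^bsub>F\<^esub> = word_class X R0 []"
    by (simp_all add: F word_monoid_def)
  have multF: "word_class X R0 u \<otimes>\<^bsub>F\<^esub> word_class X R0 v = word_class X R0 (u @ v)"
    if "u \<in> lists X" "v \<in> lists X" for u v
    unfolding F using that by (rule word_monoid_mult)
  have conj_S: "{g \<otimes>\<^bsub>F\<^esub> r \<otimes>\<^bsub>F\<^esub> inv\<^bsub>F\<^esub> g | g r. g \<in> carrier F \<and> r \<in> S} \<subseteq> carrier F"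
    using S(2) by (auto simp: F_def[symmetric])
  have normal: "N \<lhd> F"
    unfolding N_def normal_closure_def
  proof (rule F.normal_generateI[OF conj_S])
    fix h g
    assume "h \<in> {g \<otimes>\<^bsub>F\<^esub> r \<otimes>\<^bsub>F\<^esub> inv\<^bsub>F\<^esub> g | g r. g \<in> carrier F \<and> r \<in> S}" and g: "g \<in> carrier F"
    then obtain k r where kr: "h = k \<otimes>\<^bsub>F\<^esub> r \<otimes>\<^bsub>F\<^esub> inv\<^bsub>F\<^esub> k" "k \<in> carrier F" "r \<in> S" by blast
    then have "r \<in> carrier F" using S(2) by (auto simp: F_def)
    then have "g \<otimes>\<^bsub>F\<^esub> h \<otimes>\<^bsub>F\<^esub> inv\<^bsub>F\<^esub> g = (g \<otimes>\<^bsub>F\<^esub> k) \<otimes>\<^bsub>F\<^esub> r \<otimes>\<^bsub>F\<^esub> inv\<^bsub>F\<^esub> (g \<otimes>\<^bsub>F\<^esub> k)"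
      using g kr by (simp add: F.inv_mult_group F.m_assoc)
    then show "g \<otimes>\<^bsub>F\<^esub> h \<otimes>\<^bsub>F\<^esub> inv\<^bsub>F\<^esub> g \<in> {g \<otimes>\<^bsub>F\<^esub> r \<otimes>\<^bsub>F\<^esub> inv\<^bsub>F\<^esub> g | g r. g \<in> carrier F \<and> r \<in> S}"
      using g kr by blast
  qed
  interpret N: normal N F by (rule normal)
  interpret Q: group "F Mod N" by (rule N.factorgroup_is_group)
  obtain \<psi> where \<psi>: "\<psi> \<in> iso (F Mod N) P"
    using iso unfolding F_def[symmetric] N_def[symmetric] is_iso_def by blast
  have \<psi>hom: "\<psi> \<in> hom (F Mod N) P" and bij: "bij_betw \<psi> (carrier (F Mod N)) (carrier P)"
    using \<psi> by (auto simp: iso_def)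
  define \<pi> where "\<pi> = \<psi> \<circ> (\<lambda>a. N #>\<^bsub>F\<^esub> a)"
  have \<pi>hom: "\<pi> \<in> hom F P"
    unfolding \<pi>_def using N.r_coset_hom_Mod \<psi>hom by (rule hom_compose)
  interpret \<pi>: group_hom F P \<pi>
    using \<pi>hom by unfold_locales
  have cosets: "carrier (F Mod N) = (\<lambda>a. N #>\<^bsub>F\<^esub> a) ` carrier F"
    by (auto simp: FactGroup_def RCOSETS_def)
  have surj: "\<pi> ` carrier F = carrier P"
    using bij unfolding cosets \<pi>_def bij_betw_def by (simp add: image_comp)
  have kernel: "a \<in> N" if "a \<in> carrier F" "\<pi> a = \<one>\<^bsub>P\<^esub>" for a
  proof -
    have "\<psi> (N #>\<^bsub>F\<^esub> a) = \<psi> (N #>\<^bsub>F\<^esub> \<one>\<^bsub>F\<^esub>)" using that(2) \<pi>.hom_one by (simp add: \<pi>_def)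
    then have "N #>\<^bsub>F\<^esub> a = N #>\<^bsub>F\<^esub> \<one>\<^bsub>F\<^esub>"
      using bij that(1) unfolding bij_betw_def cosets by (auto dest: inj_onD)
    then show ?thesis using that(1) F.rcos_self[OF that(1) N.is_subgroup] N.subset by simp
  qed
  have S_trivial: "\<pi> r = \<one>\<^bsub>P\<^esub>" if r: "r \<in> S" for r
  proof -
    have rF: "r \<in> carrier F" using S(2) r by (auto simp: F_def)
    have "\<one>\<^bsub>F\<^esub> \<otimes>\<^bsub>F\<^esub> r \<otimes>\<^bsub>F\<^esub> inv\<^bsub>F\<^esub> \<one>\<^bsub>F\<^esub> \<in> N"
      unfolding N_def normal_closure_def using r by (intro generate.incl) blast
    then have "r \<in> N" using rF by simp
    then have "N #>\<^bsub>F\<^esub> r = N #>\<^bsub>F\<^esub> \<one>\<^bsub>F\<^esub>"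
      using F.coset_join2[OF rF N.is_subgroup] N.subset by simp
    then show ?thesis using \<pi>.hom_one by (simp add: \<pi>_def)
  qed
  define f where "f a = \<pi> (word_class X R0 [a])" for a
  have fX: "f ` X \<subseteq> carrier P"
    by (auto simp: f_def carF intro!: \<pi>.hom_closed)
  have eval: "word_eval P f w = \<pi> (word_class X R0 w)" if "w \<in> lists X" for w
    using that
  proof (induction w)
    case Nil
    then show ?case using \<pi>.hom_one by (simp add: oneF)
  next
    case (Cons a w)
    have "word_class X R0 [a] \<in> carrier F" "word_class X R0 w \<in> carrier F"
      using Cons by (auto simp: carF)
    then show ?case
      using Cons multF[of "[a]" w] \<pi>.hom_mult[of "word_class X R0 [a]" "word_class X R0 w"]
      by (simp add: f_def)
  qed
  define rep where "rep r = (SOME w. w \<in> lists X \<and> word_class X R0 w = r)" for r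
  have rep: "rep r \<in> lists X" "word_class X R0 (rep r) = r" if "r \<in> carrier F" for r
    using someI_ex[of "\<lambda>w. w \<in> lists X \<and> word_class X R0 w = r"] that
    by (auto simp: rep_def carF)
  have SF: "r \<in> carrier F" if "r \<in> S" for r using S(2) that by (auto simp: F_def)
  define R where "R = R0 \<union> (\<lambda>r. (rep r, [])) ` S"
  have "R0 = (\<lambda>(x, b). ([(x, b), (x, \<not> b)], [])) ` X" by (auto simp: R0_def X_def)
  then have finR0: "finite R0" by (simp add: X_def)
  have subR0: "R0 \<subseteq> lists X \<times> lists X" by (auto simp: R0_def X_def)
  \<comment> \<open>The classes of words that the relations of \<open>R\<close> make trivial form a subgroup. It contains the
    conjugates of the relators, hence their normal closure \<open>N\<close>, the kernel of \<open>\<pi>\<close>.\<close>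
  define T where "T = {word_class X R0 w | w. w \<in> lists X \<and> word_cong X R w []}"
  have lift: "word_cong X R u v" if "word_class X R0 u = word_class X R0 v" "u \<in> lists X" for u v
    using that word_class_eq_iff[of u X R0 v] word_cong_mono[of X R0 u v R] by (auto simp: R_def)
  have T: "subgroup T F"
  proof (rule F.subgroupI)
    show "T \<subseteq> carrier F" by (auto simp: T_def carF)
    have "word_class X R0 [] \<in> T" unfolding T_def using word_refl[of "[]"] by fastforce
    then show "T \<noteq> {}" by blast
  next
    fix a assume "a \<in> T"
    then obtain u where u: "u \<in> lists X" "word_cong X R u []" "a = word_class X R0 u"
      by (auto simp: T_def)
    then have "a \<in> carrier F" by (auto simp: carF)
    then have "inv\<^bsub>F\<^esub> a \<in> carrier F" by simp
    then obtain v where v: "v \<in> lists X" "inv\<^bsub>F\<^esub> a = word_class X R0 v" by (auto simp: carF)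
    have "word_class X R0 (u @ v) = word_class X R0 []"
      using multF[OF u(1) v(1)] \<open>a \<in> carrier F\<close> u(3) v(2) oneF by (metis F.r_inv)
    then have 1: "word_cong X R (u @ v) []" using u v by (intro lift) auto
    have "word_cong X R (u @ v) ([] @ v)" using u(2) v(1) by (intro word_append word_refl)
    then have "word_cong X R v (u @ v)" by (simp add: word_sym)
    then have "word_cong X R v []" using 1 by (rule word_trans)
    then show "inv\<^bsub>F\<^esub> a \<in> T" using v by (auto simp: T_def)
  next
    fix a b assume "a \<in> T" "b \<in> T"
    then obtain u v where u: "u \<in> lists X" "word_cong X R u []" "a = word_class X R0 u"
      and v: "v \<in> lists X" "word_cong X R v []" "b = word_class X R0 v"
      by (auto simp: T_def)
    have "word_cong X R (u @ v) []" using word_append[OF u(2) v(2)] by simp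
    then show "a \<otimes>\<^bsub>F\<^esub> b \<in> T"
      using u v multF[OF u(1) v(1)] by (auto simp: T_def intro!: exI[of _ "u @ v"])
  qed
  have "{g \<otimes>\<^bsub>F\<^esub> r \<otimes>\<^bsub>F\<^esub> inv\<^bsub>F\<^esub> g | g r. g \<in> carrier F \<and> r \<in> S} \<subseteq> T"
  proof clarify
    fix g r assume g: "g \<in> carrier F" and r: "r \<in> S"
    from g obtain u where u: "u \<in> lists X" "g = word_class X R0 u" by (auto simp: carF)
    from g have "inv\<^bsub>F\<^esub> g \<in> carrier F" by simp
    then obtain v where v: "v \<in> lists X" "inv\<^bsub>F\<^esub> g = word_class X R0 v" by (auto simp: carF)
    note rr = rep[OF SF[OF r]]
    have "word_class X R0 (u @ v) = word_class X R0 []"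
      using multF[OF u(1) v(1)] g u(2) v(2) oneF by (metis F.r_inv)
    then have uv: "word_cong X R (u @ v) []" using u v by (intro lift) auto
    have "word_cong X R (rep r) []"
      using r rr by (intro word_rule) (auto simp: R_def)
    then have "word_cong X R (u @ rep r @ v) (u @ [] @ v)"
      using u(1) v(1) by (intro word_append word_refl)
    then have "word_cong X R ((u @ rep r) @ v) []" using uv by (auto intro: word_trans)
    moreover have "g \<otimes>\<^bsub>F\<^esub> r \<otimes>\<^bsub>F\<^esub> inv\<^bsub>F\<^esub> g = word_class X R0 ((u @ rep r) @ v)"
      using multF[OF u(1) rr(1)] multF[of "u @ rep r" v] u v rr by simp
    ultimately show "g \<otimes>\<^bsub>F\<^esub> r \<otimes>\<^bsub>F\<^esub> inv\<^bsub>F\<^esub> g \<in> T"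
      using u v rr unfolding T_def by (intro CollectI exI[of _ "(u @ rep r) @ v"]) simp
  qed
  then have NT: "N \<subseteq> T"
    unfolding N_def normal_closure_def using T by (rule F.generate_subgroup_incl)
  show thesis
  proof (rule that[of X R f])
    show "finite X" by (simp add: X_def)
    show "finite R" using finR0 S(1) by (simp add: R_def)
    show "R \<subseteq> lists X \<times> lists X" using subR0 rep(1) SF unfolding R_def by blast
    show "f ` X \<subseteq> carrier P" by (rule fX)
    show "word_eval P f u = word_eval P f v" if "(u, v) \<in> R" for u v
    proof (cases "(u, v) \<in> R0")
      case True
      then have "u \<in> lists X" "v \<in> lists X" using subR0 by blast+
      moreover from this True have "word_class X R0 u = word_class X R0 v"
        by (intro word_class_eq word_rule)
      ultimately show ?thesis by (simp add: eval)
    next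
      case False
      then obtain r where r: "r \<in> S" "u = rep r" "v = []" using \<open>(u, v) \<in> R\<close> by (auto simp: R_def)
      then show ?thesis using rep[OF SF[OF r(1)]] S_trivial[OF r(1)] by (simp add: eval)
    qed
    show "\<exists>w\<in>lists X. word_eval P f w = p" if "p \<in> carrier P" for p
      using that eval unfolding surj[symmetric] carF by (auto)
    show "word_cong X R w []" if w: "w \<in> lists X" "word_eval P f w = \<one>\<^bsub>P\<^esub>" for w
    proof -
      have "word_class X R0 w \<in> carrier F" using w by (auto simp: carF)
      then have "word_class X R0 w \<in> T" using kernel NT eval[OF w(1)] w(2) by auto
      then obtain v where "v \<in> lists X" "word_cong X R v []" "word_class X R0 w = word_class X R0 v"
        by (auto simp: T_def)
      then show ?thesis using lift[of w v] w(1) by (blast intro: word_trans)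
    qed
  qed
qed

section \<open>Reduced words in free products of subgroups\<close>

definition free_product_rules ::
  "('a, 'm) monoid_scheme \<Rightarrow> 'a set \<Rightarrow> 'a set \<Rightarrow> (('a + 'a) list \<times> ('a + 'a) list) set" where
  "free_product_rules G A B =
     {([Inl x, Inl y], [Inl (x \<otimes>\<^bsub>G\<^esub> y)]) | x y. x \<in> A \<and> y \<in> A}
      \<union> {([Inr x, Inr y], [Inr (x \<otimes>\<^bsub>G\<^esub> y)]) | x y. x \<in> B \<and> y \<in> B}
      \<union> {([Inl \<one>\<^bsub>G\<^esub>], []), ([Inr \<one>\<^bsub>G\<^esub>], [])}"

lemma subgroup_free_product_eq:
  "subgroup_free_product G A B = word_monoid (A <+> B) (free_product_rules G A B)"
  by (simp add: subgroup_free_product_def free_product_def free_product_rules_def)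

definition reduced :: "('a, 'm) monoid_scheme \<Rightarrow> ('a + 'a) list \<Rightarrow> bool" where
  "reduced G w \<longleftrightarrow>
    (\<forall>x\<in>set w. case_sum id id x \<noteq> \<one>\<^bsub>G\<^esub>) \<and> successively (\<lambda>x y. isl x \<noteq> isl y) w"

lemma reduced_Cons:
  "reduced G (x # w) \<longleftrightarrow>
    case_sum id id x \<noteq> \<one>\<^bsub>G\<^esub> \<and> reduced G w \<and> (w \<noteq> [] \<longrightarrow> isl x \<noteq> isl (hd w))"
  by (auto simp: reduced_def successively_Cons)

context group
begin

lemma ex_reduced_word_cong:
  assumes A: "subgroup A G" and B: "subgroup B G" and w: "w \<in> lists (A <+> B)"
  shows "\<exists>v\<in>lists (A <+> B). reduced G v \<and> word_cong (A <+> B) (free_product_rules G A B) w v"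
  using w
proof (induction w)
  case Nil
  then show ?case by (intro bexI[of _ "[]"]) (auto simp: reduced_def intro: word_refl)
next
  case (Cons x w)
  let ?X = "A <+> B" and ?R = "free_product_rules G A B"
  obtain v where v: "v \<in> lists ?X" "reduced G v" "word_cong ?X ?R w v"
    using Cons by blast
  have x: "[x] \<in> lists ?X" using Cons by simp
  have cong: "word_cong ?X ?R (x # w) ([x] @ v)"
    using word_append[OF word_refl[OF x] v(3)] by simp
  show ?case
  proof (cases "case_sum id id x = \<one>")
    case True
    then have "([x], []) \<in> ?R" by (cases x) (auto simp: free_product_rules_def)
    then have "word_cong ?X ?R [x] []" using x by (intro word_rule) auto
    then have "word_cong ?X ?R ([x] @ v) ([] @ v)" using v(1) by (intro word_append word_refl)
    then show ?thesis using v cong by (metis append_Nil word_trans)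
  next
    case nontrivial: False
    show ?thesis
    proof (cases "v \<noteq> [] \<and> isl x = isl (hd v)")
      case False
      then have "reduced G (x # v)" using v(2) nontrivial by (auto simp: reduced_Cons)
      moreover have "x # v \<in> lists ?X" using x v(1) by simp
      ultimately show ?thesis using cong by (intro bexI[of _ "x # v"]) auto
    next
      case True
      then obtain y u where vu: "v = y # u" and xy: "isl x = isl y" by (cases v) auto
      have y: "y \<in> ?X" and u: "u \<in> lists ?X" "reduced G u" and yu: "u \<noteq> [] \<longrightarrow> isl y \<noteq> isl (hd u)"
        using v by (auto simp: vu reduced_Cons)
      obtain z where z: "z \<in> ?X" "([x, y], [z]) \<in> ?R" "isl z = isl y"
        using x y xy subgroup.m_closed[OF A] subgroup.m_closed[OF B]
        by (cases x; cases y) (auto simp: free_product_rules_def)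
      have "word_cong ?X ?R [x, y] [z]" using x y z by (intro word_rule) auto
      then have "word_cong ?X ?R ([x, y] @ u) ([z] @ u)" using u(1) by (intro word_append word_refl)
      then have zu: "word_cong ?X ?R (x # w) ([z] @ u)"
        using cong by (auto simp: vu intro: word_trans)
      show ?thesis
      proof (cases "case_sum id id z = \<one>")
        case True
        then have "([z], []) \<in> ?R" by (cases z) (auto simp: free_product_rules_def)
        then have "word_cong ?X ?R [z] []" using z by (intro word_rule) auto
        then have "word_cong ?X ?R ([z] @ u) ([] @ u)" using u(1) by (intro word_append word_refl)
        then show ?thesis using u zu by (metis append_Nil word_trans)
      next
        case False
        then have "reduced G (z # u)" using u(2) yu z(3) by (auto simp: reduced_Cons)
        then show ?thesis using zu z u by (intro bexI[of _ "z # u"]) auto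
      qed
    qed
  qed
qed

text \<open>Since every word is congruent to a reduced one, a nontrivial element of the kernel of the natural
morphism is represented by a nonempty reduced word with value \<open>\<one>\<close>.\<close>

lemma natural_morphism_inj:
  assumes A: "subgroup A G" and B: "subgroup B G"
    and trivial: "\<And>w. w \<in> lists (A <+> B) \<Longrightarrow> reduced G w \<Longrightarrow>
      word_eval G (case_sum id id) w = \<one> \<Longrightarrow> w = []"
  shows "inj_on (natural_morphism G) (carrier (subgroup_free_product G A B))"
proof -
  let ?X = "A <+> B" and ?R = "free_product_rules G A B" and ?e = "word_eval G (case_sum id id)"
  let ?P = "subgroup_free_product G A B"
  interpret P: group ?P
    unfolding subgroup_free_product_def
    by (intro group_free_product subgroup_imp_group A B)
  have car: "carrier ?P = word_class ?X ?R ` lists ?X" and one: "\<one>\<^bsub>?P\<^esub> = word_class ?X ?R []"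
    by (simp_all add: subgroup_free_product_eq word_monoid_def)
  have mult: "word_class ?X ?R u \<otimes>\<^bsub>?P\<^esub> word_class ?X ?R v = word_class ?X ?R (u @ v)"
    if "u \<in> lists ?X" "v \<in> lists ?X" for u v
    unfolding subgroup_free_product_eq using that by (rule word_monoid_mult)
  have im: "case_sum id id ` ?X \<subseteq> carrier G"
    using subgroup.subset[OF A] subgroup.subset[OF B] by auto
  then have letters: "case_sum id id ` set w \<subseteq> carrier G" if "w \<in> lists ?X" for w
    using that by auto
  have cong: "?e u = ?e v" if "word_cong ?X ?R u v" for u v
    using that im
    by (rule word_eval_cong)
      (auto simp: free_product_rules_def subgroup.mem_carrier[OF A] subgroup.mem_carrier[OF B])
  have nat: "natural_morphism G (word_class ?X ?R w) = ?e w" if w: "w \<in> lists ?X" for w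
  proof -
    obtain X where X: "X \<in> carrier ?P" "w \<in> X" "natural_morphism G X = ?e w"
      using natural_morphism_class[OF A B w] by blast
    then obtain v where "X = word_class ?X ?R v" by (auto simp: car)
    with X(2) have "X = word_class ?X ?R w"
      by (simp add: word_class_def) (metis word_class_def word_class_eq)
    with X(3) show ?thesis by simp
  qed
  have kernel: "word_class ?X ?R w = \<one>\<^bsub>?P\<^esub>" if w: "w \<in> lists ?X" "?e w = \<one>" for w
  proof -
    obtain v where v: "v \<in> lists ?X" "reduced G v" "word_cong ?X ?R w v"
      using ex_reduced_word_cong[OF A B w(1)] by blast
    have "?e v = \<one>" using cong[OF v(3)] w(2) by simp
    then have "v = []" using trivial v by blast
    then show ?thesis using v(3) by (simp add: one word_class_eq)
  qed
  show ?thesis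
  proof (rule inj_onI)
    fix Y Z assume Y: "Y \<in> carrier ?P" and Z: "Z \<in> carrier ?P"
      and eq: "natural_morphism G Y = natural_morphism G Z"
    obtain u where u: "u \<in> lists ?X" "Y = word_class ?X ?R u" using Y by (auto simp: car)
    obtain v where v: "v \<in> lists ?X" "Z = word_class ?X ?R v" using Z by (auto simp: car)
    have "inv\<^bsub>?P\<^esub> Z \<in> carrier ?P" using Z by simp
    then obtain v' where v': "v' \<in> lists ?X" "inv\<^bsub>?P\<^esub> Z = word_class ?X ?R v'"
      by (auto simp: car)
    have "word_class ?X ?R (v @ v') = word_class ?X ?R []"
      using mult[OF v(1) v'(1)] Z by (simp add: v(2)[symmetric] v'(2)[symmetric] one)
    then have "word_cong ?X ?R (v @ v') []" using v v' by (simp add: word_class_eq_iff)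
    then have "?e (v @ v') = \<one>" using cong by fastforce
    moreover have "?e u = ?e v" using eq u v nat by simp
    ultimately have "?e (u @ v') = \<one>"
      using u v v' letters by (simp add: word_eval_append)
    then have "Y \<otimes>\<^bsub>?P\<^esub> inv\<^bsub>?P\<^esub> Z = \<one>\<^bsub>?P\<^esub>"
      using kernel[of "u @ v'"] mult[OF u(1) v'(1)] u v' by simp
    then have "Y = inv\<^bsub>?P\<^esub> (inv\<^bsub>?P\<^esub> Z)" using Y Z by (intro P.inv_equality[symmetric]) auto
    then show "Y = Z" using Z by simp
  qed
qed

end

section \<open>Supports in a halo\<close>

lemma (in group) finite_translates_meeting:
  assumes "finite S" "finite T" "S \<subseteq> carrier G" "T \<subseteq> carrier G"
  shows "finite {g \<in> carrier G. (g <# S) \<inter> T \<noteq> {}}"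
proof (rule finite_subset)
  show "{g \<in> carrier G. (g <# S) \<inter> T \<noteq> {}} \<subseteq> (\<lambda>(t, s). t \<otimes> inv s) ` (T \<times> S)"
  proof
    fix g assume "g \<in> {g \<in> carrier G. (g <# S) \<inter> T \<noteq> {}}"
    then obtain s where s: "g \<in> carrier G" "s \<in> S" "g \<otimes> s \<in> T"
      by (auto simp: l_coset_def)
    then have "g = (g \<otimes> s) \<otimes> inv s" using assms(3) by (simp add: m_assoc subsetD)
    then show "g \<in> (\<lambda>(t, s). t \<otimes> inv s) ` (T \<times> S)" using s by force
  qed
  show "finite ((\<lambda>(t, s). t \<otimes> inv s) ` (T \<times> S))" using assms by simp
qed

context halo
begin

lemma group_total: "group (L (carrier H))"
  by (rule halo_group) simp

lemma subgroup_halo: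
  assumes "S \<subseteq> carrier H"
  shows "subgroup (carrier (L S)) (L (carrier H))"
proof -
  interpret group_hom "L S" "L (carrier H)" "\<lambda>x. x"
    using halo_group[OF assms] group_total halo_mono[OF assms order_refl]
    by (simp add: group_hom_def group_hom_axioms_def)
  show ?thesis using img_is_subgroup by simp
qed

lemma halo_carrier_mono:
  "R \<subseteq> S \<Longrightarrow> S \<subseteq> carrier H \<Longrightarrow> carrier (L R) \<subseteq> carrier (L S)"
  using halo_mono[of R S] by (auto simp: hom_def)

text \<open>This is where the intersection axiom enters: it supplies the trivial intersections that make a word
alternate in the amalgam.\<close>

lemma halo_disjoint:
  assumes "R \<subseteq> carrier H" "S \<subseteq> carrier H" "R \<inter> S = {}"
  shows "carrier (L R) \<inter> carrier (L S) = {\<one>\<^bsub>L (carrier H)\<^esub>}"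
  using halo_Int[OF assms(1,2)] halo_empty subgroup.one_closed[OF subgroup_halo[of "{}"]] assms(3)
  by simp

text \<open>The groups \<open>L(S)\<close> with \<open>S\<close> finite form a directed family, so their union is a subgroup, and it generates
\<open>L(H)\<close>.\<close>

lemma finite_support:
  assumes "x \<in> carrier (L (carrier H))"
  shows "\<exists>S. finite S \<and> S \<subseteq> carrier H \<and> x \<in> carrier (L S)"
proof -
  let ?U = "\<Union>S\<in>{S. S \<subseteq> carrier H \<and> finite S}. carrier (L S)"
  have "x \<in> generate (L (carrier H)) ?U"
    using assms halo_generated by simp
  then show ?thesis
  proof (induction rule: generate.induct)
    case one
    then show ?case using subgroup.one_closed[OF subgroup_halo[of "{}"]] by blast
  next
    case (incl x)
    then show ?case by blast
  next
    case (inv x)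
    then obtain S where S: "S \<subseteq> carrier H" "finite S" "x \<in> carrier (L S)" by blast
    then show ?case using subgroup.m_inv_closed[OF subgroup_halo[OF S(1)] S(3)] by blast
  next
    case (eng x y)
    then obtain S T where S: "finite S" "S \<subseteq> carrier H" "x \<in> carrier (L S)"
      and T: "finite T" "T \<subseteq> carrier H" "y \<in> carrier (L T)" by blast
    have "S \<union> T \<subseteq> carrier H" using S T by blast
    moreover from this have "x \<in> carrier (L (S \<union> T))" "y \<in> carrier (L (S \<union> T))"
      using S T halo_carrier_mono[of S "S \<union> T"] halo_carrier_mono[of T "S \<union> T"] by auto
    ultimately show ?case
      using S(1) T(1) subgroup.m_closed[OF subgroup_halo[of "S \<union> T"]] by (metis finite_UnI)
  qed
qed

lemma finite_support_set:
  assumes "finite E" "E \<subseteq> carrier (L (carrier H))"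
  shows "\<exists>S. finite S \<and> S \<subseteq> carrier H \<and> E \<subseteq> carrier (L S)"
  using assms
proof (induction E rule: finite_induct)
  case empty
  then show ?case by auto
next
  case (insert x E)
  obtain S where S: "finite S" "S \<subseteq> carrier H" "E \<subseteq> carrier (L S)" using insert by auto
  obtain T where T: "finite T" "T \<subseteq> carrier H" "x \<in> carrier (L T)"
    using finite_support insert.prems by blast
  have "S \<union> T \<subseteq> carrier H" using S T by blast
  moreover from this have "insert x E \<subseteq> carrier (L (S \<union> T))"
    using S T halo_carrier_mono[of S "S \<union> T"] halo_carrier_mono[of T "S \<union> T"] by auto
  ultimately show ?case using S(1) T(1) by (metis finite_UnI)
qed

end

section \<open>Relations in a finitely presented halo product are local\<close>

lemma word_eval_subgroup_hom:
  assumes "group G" "group Q" "subgroup S G" "\<theta> \<in> hom (G\<lparr>carrier := S\<rparr>) Q" "set xs \<subseteq> S"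
  shows "word_eval G (\<lambda>x. x) xs \<in> S \<and> word_eval Q \<theta> xs = \<theta> (word_eval G (\<lambda>x. x) xs)"
proof -
  interpret S: group_hom "G\<lparr>carrier := S\<rparr>" Q \<theta>
    using assms by (simp add: group_hom_def group_hom_axioms_def group.subgroup_imp_group)
  show ?thesis
    using assms(5)
  proof (induction xs)
    case Nil
    then show ?case using S.hom_one subgroup.one_closed[OF assms(3)] by simp
  next
    case (Cons x xs)
    then show ?case
      using S.hom_mult[of x "word_eval G (\<lambda>x. x) xs"] subgroup.m_closed[OF assms(3)] by simp
  qed
qed

context halo_action
begin

abbreviation "N \<equiv> L (carrier H)"
abbreviation "P \<equiv> halo_product H L \<alpha>"

sublocale N: group N by (rule group_total)
sublocale P: group P
  unfolding halo_product_def
  by (rule group_semidirect_product[OF group_total H.is_group action_hom])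

lemma P_simps:
  "carrier P = carrier N \<times> carrier H"
  "(x, g) \<otimes>\<^bsub>P\<^esub> (y, h) = (x \<otimes>\<^bsub>N\<^esub> \<alpha> g y, g \<otimes> h)"
  "\<one>\<^bsub>P\<^esub> = (\<one>\<^bsub>N\<^esub>, \<one>)"
  by (simp_all add: halo_product_def semidirect_product_def)

lemma P_mult: "p \<otimes>\<^bsub>P\<^esub> q = (fst p \<otimes>\<^bsub>N\<^esub> \<alpha> (snd p) (fst q), snd p \<otimes> snd q)"
  by (cases p; cases q) (simp add: P_simps)

lemma action_auto: "g \<in> carrier H \<Longrightarrow> \<alpha> g \<in> auto N"
  using hom_in_carrier[OF action_hom] by (simp add: AutoGroup_def)

lemma action_closed: "g \<in> carrier H \<Longrightarrow> x \<in> carrier N \<Longrightarrow> \<alpha> g x \<in> carrier N"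
  using action_auto[of g] by (auto simp: auto_def hom_def)

lemma action_mult:
  "g \<in> carrier H \<Longrightarrow> x \<in> carrier N \<Longrightarrow> y \<in> carrier N \<Longrightarrow> \<alpha> g (x \<otimes>\<^bsub>N\<^esub> y) = \<alpha> g x \<otimes>\<^bsub>N\<^esub> \<alpha> g y"
  using action_auto[of g] by (auto simp: auto_def hom_def)

lemma action_comp:
  "g \<in> carrier H \<Longrightarrow> h \<in> carrier H \<Longrightarrow> x \<in> carrier N \<Longrightarrow> \<alpha> (g \<otimes> h) x = \<alpha> g (\<alpha> h x)"
  using hom_mult[OF action_hom, of g h] action_auto[of g] action_auto[of h]
  by (simp add: AutoGroup_def BijGroup_def auto_def compose_def)

lemma action_one:
  assumes "x \<in> carrier N"
  shows "\<alpha> \<one> x = x"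
proof -
  interpret A: group "AutoGroup N" by (rule N.AutoGroup)
  interpret \<alpha>: group_hom H "AutoGroup N" \<alpha>
    using action_hom by unfold_locales
  show ?thesis using \<alpha>.hom_one assms by (simp add: AutoGroup_def BijGroup_def)
qed

lemma action_unit:
  assumes "g \<in> carrier H"
  shows "\<alpha> g \<one>\<^bsub>N\<^esub> = \<one>\<^bsub>N\<^esub>"
  using action_mult[OF assms N.one_closed N.one_closed] action_closed[OF assms N.one_closed]
    N.l_cancel_one'[of "\<alpha> g \<one>\<^bsub>N\<^esub>" "\<alpha> g \<one>\<^bsub>N\<^esub>"] by simp

lemma translate_in:
  "g \<in> carrier H \<Longrightarrow> S \<subseteq> carrier H \<Longrightarrow> x \<in> carrier (L S) \<Longrightarrow> \<alpha> g x \<in> carrier (L (g <# S))"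
  using action_translate[of g S] by blast

text \<open>The word in \<open>N\<close> that a word of \<open>P\<close> traces when it is read from the position \<open>g\<close> of \<open>H\<close>. This map is the
free version of the projection of \<open>N \<rtimes> H\<close> onto \<open>N\<close>, a crossed homomorphism (\<open>trace_append\<close>). The
letters are left unmultiplied so that they can be evaluated in groups other than \<open>N\<close>.\<close>

primrec trace :: "('x \<Rightarrow> 'l \<times> 'h) \<Rightarrow> 'h \<Rightarrow> 'x list \<Rightarrow> 'l list" where
  "trace f g [] = []"
| "trace f g (x # w) = \<alpha> g (fst (f x)) # trace f (g \<otimes> snd (f x)) w"

lemma eval_in:
  assumes "f ` X \<subseteq> carrier P" "w \<in> lists X"
  shows "word_eval P f w \<in> carrier P"
    "fst (word_eval P f w) \<in> carrier N" "snd (word_eval P f w) \<in> carrier H"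
proof -
  show "word_eval P f w \<in> carrier P" using assms by (intro P.word_eval_closed) auto
  then show "fst (word_eval P f w) \<in> carrier N" "snd (word_eval P f w) \<in> carrier H"
    by (auto simp: P_simps)
qed

lemma trace_append:
  assumes f: "f ` X \<subseteq> carrier P" and g: "g \<in> carrier H" and u: "u \<in> lists X"
  shows "trace f g (u @ v) = trace f g u @ trace f (g \<otimes> snd (word_eval P f u)) v"
  using u g
proof (induction u arbitrary: g)
  case Nil
  then show ?case by (simp add: P_simps)
next
  case (Cons x u)
  have "f x \<in> carrier P" using f Cons by auto
  then have "snd (f x) \<in> carrier H" by (auto simp: P_simps)
  then show ?case using Cons eval_in[OF f, of u]
    by (simp add: P_mult H.m_assoc)
qed

lemma trace_translate:
  assumes f: "f ` X \<subseteq> carrier P" and g: "g \<in> carrier H" and k: "k \<in> carrier H" and w: "w \<in> lists X"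
  shows "trace f (g \<otimes> k) w = map (\<alpha> g) (trace f k w)"
  using w k
proof (induction w arbitrary: k)
  case Nil
  then show ?case by simp
next
  case (Cons x w)
  have "f x \<in> carrier P" using f Cons by auto
  then have "fst (f x) \<in> carrier N" "snd (f x) \<in> carrier H" by (auto simp: P_simps)
  then show ?case using Cons g
    by (simp add: H.m_assoc action_comp)
qed

lemma trace_in:
  assumes f: "f ` X \<subseteq> carrier P" and g: "g \<in> carrier H" and w: "w \<in> lists X"
  shows "set (trace f g w) \<subseteq> {\<alpha> k (fst (f x)) | k x. k \<in> carrier H \<and> x \<in> X}"
  using w g
proof (induction w arbitrary: g)
  case Nil
  then show ?case by simp
next
  case (Cons x w)
  have "f x \<in> carrier P" using f Cons by auto
  then have "g \<otimes> snd (f x) \<in> carrier H" using Cons by (auto simp: P_simps)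
  with Cons show ?case by auto
qed

lemma eval_trace:
  assumes f: "f ` X \<subseteq> carrier P" and g: "g \<in> carrier H" and w: "w \<in> lists X"
  shows "word_eval N (\<lambda>x. x) (trace f g w) = \<alpha> g (fst (word_eval P f w))"
  using w g
proof (induction w arbitrary: g)
  case Nil
  then show ?case by (simp add: P_simps action_unit)
next
  case (Cons x w)
  have "f x \<in> carrier P" using f Cons by auto
  then have "fst (f x) \<in> carrier N" "snd (f x) \<in> carrier H" by (auto simp: P_simps)
  then show ?case using Cons eval_in[OF f, of w]
    by (simp add: P_mult action_comp action_mult action_closed)
qed

text \<open>The finite set \<open>K\<close> is chosen to support \<open>F\<close>, the letters, and the traces of finitely many words: the two
sides of each relation, words for the elements of \<open>F\<close> and their inverses, and words for the images in
\<open>H\<close> of the letters. Evaluating the trace of such a word through \<open>\<theta>\<close> then depends only on its value in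
\<open>P\<close>, because \<open>\<theta>\<close> is multiplicative on the translates of \<open>L(K)\<close>. So evaluated traces are invariant
under the word congruence of the presentation, and a relation between translates of \<open>\<langle>F\<rangle>\<close>, lifted to a
word with value \<open>\<one>\<close> in \<open>P\<close>, evaluates to \<open>\<one>\<close> in \<open>Q\<close>.\<close>

lemma finitely_presented_local_relations:
  assumes fp: "finitely_presented P" and F: "finite F" "F \<subseteq> carrier N"
  obtains K where "finite K" "K \<subseteq> carrier H" "K \<noteq> {}" "F \<subseteq> carrier (L K)"
    "\<And>(Q :: 'q monoid) \<theta> ys. group Q \<Longrightarrow>
      (\<And>g. g \<in> carrier H \<Longrightarrow> \<theta> \<in> hom (N\<lparr>carrier := carrier (L (g <# K))\<rparr>) Q) \<Longrightarrow>
      set ys \<subseteq> {\<alpha> g a | g a. g \<in> carrier H \<and> a \<in> generate N F} \<Longrightarrow>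
      word_eval N (\<lambda>x. x) ys = \<one>\<^bsub>N\<^esub> \<Longrightarrow> word_eval Q \<theta> ys = \<one>\<^bsub>Q\<^esub>"
proof -
  obtain X :: "(nat \<times> bool) set" and R f where
    X: "finite X" and R: "finite R" "R \<subseteq> lists X \<times> lists X" and f: "f ` X \<subseteq> carrier P"
    and R_eval: "\<And>u v. (u, v) \<in> R \<Longrightarrow> word_eval P f u = word_eval P f v"
    and surj: "\<And>p. p \<in> carrier P \<Longrightarrow> \<exists>w\<in>lists X. word_eval P f w = p"
    and complete: "\<And>w. w \<in> lists X \<Longrightarrow> word_eval P f w = \<one>\<^bsub>P\<^esub> \<Longrightarrow> word_cong X R w []"
    by (rule finitely_presented_word_cong[OF P.is_group fp]) (rule that; assumption)
  define wd where "wd p = (SOME w. w \<in> lists X \<and> word_eval P f w = p)" for p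
  have wd: "wd p \<in> lists X" "word_eval P f (wd p) = p" if "p \<in> carrier P" for p
    using someI_ex[of "\<lambda>w. w \<in> lists X \<and> word_eval P f w = p"] surj[OF that]
    by (auto simp: wd_def)
  have fx: "fst (f x) \<in> carrier N" "snd (f x) \<in> carrier H" if "x \<in> X" for x
  proof -
    have "f x \<in> carrier P" using f that by blast
    then show "fst (f x) \<in> carrier N" "snd (f x) \<in> carrier H" by (auto simp: P_simps)
  qed
  define D where "D = (\<lambda>a. (a, \<one>)) ` (F \<union> (\<lambda>a. inv\<^bsub>N\<^esub> a) ` F) \<union> (\<lambda>x. (\<one>\<^bsub>N\<^esub>, snd (f x))) ` X"
  have D: "finite D" "D \<subseteq> carrier P" using F X fx by (auto simp: D_def P_simps)
  define W where "W = fst ` R \<union> snd ` R \<union> wd ` D"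
  have "fst ` R \<subseteq> lists X" "snd ` R \<subseteq> lists X" using R(2) by auto
  moreover have "wd ` D \<subseteq> lists X" using wd(1) D(2) by (intro image_subsetI) blast
  ultimately have W: "finite W" "W \<subseteq> lists X" using R(1) D(1) by (simp_all add: W_def)
  define E where "E = F \<union> (\<lambda>x. fst (f x)) ` X \<union> (\<Union>w\<in>W. set (trace f \<one> w))"
  have "set (trace f \<one> w) \<subseteq> carrier N" if "w \<in> W" for w
    using trace_in[OF f H.one_closed, of w] that W(2) action_closed fx by blast
  then have E: "finite E" "E \<subseteq> carrier N" using F X W fx by (auto simp: E_def)
  obtain K0 where K0: "finite K0" "K0 \<subseteq> carrier H" "E \<subseteq> carrier (L K0)"
    using finite_support_set[OF E] by blast
  define K where "K = insert \<one> K0"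
  have K: "finite K" "K \<subseteq> carrier H" using K0 by (auto simp: K_def)
  have EK: "E \<subseteq> carrier (L K)"
    using K0(3) halo_carrier_mono[OF _ K(2), of K0] by (auto simp: K_def)
  have FK: "F \<subseteq> carrier (L K)" using EK by (auto simp: E_def)
  note sK = subgroup_halo[OF K(2)]
  have gK: "g <# K \<subseteq> carrier H" if "g \<in> carrier H" for g
    using that K(2) by (rule H.l_coset_subset_G[rotated])
  show thesis
  proof (rule that[OF K(1,2) _ FK])
    show "K \<noteq> {}" by (simp add: K_def)
  next
    fix Q :: "'q monoid" and \<theta> ys
    assume Q: "group Q"
      and \<theta>: "\<And>g. g \<in> carrier H \<Longrightarrow> \<theta> \<in> hom (N\<lparr>carrier := carrier (L (g <# K))\<rparr>) Q"
      and ys: "set ys \<subseteq> {\<alpha> g a | g a. g \<in> carrier H \<and> a \<in> generate N F}"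
      and ys1: "word_eval N (\<lambda>x. x) ys = \<one>\<^bsub>N\<^esub>"
    interpret Q: group Q by (rule Q)
    define \<Theta> where "\<Theta> g w = word_eval Q \<theta> (trace f g w)" for g w
    have \<theta>_closed: "\<theta> (\<alpha> g a) \<in> carrier Q" if "g \<in> carrier H" "a \<in> carrier (L K)" for g a
      using hom_in_carrier[OF \<theta>[OF that(1)]] translate_in[OF that(1) K(2) that(2)] by simp
    have \<theta>_mult: "\<theta> (\<alpha> g (a \<otimes>\<^bsub>N\<^esub> b)) = \<theta> (\<alpha> g a) \<otimes>\<^bsub>Q\<^esub> \<theta> (\<alpha> g b)"
      if "g \<in> carrier H" "a \<in> carrier (L K)" "b \<in> carrier (L K)" for g a b
      using hom_mult[OF \<theta>[OF that(1)], of "\<alpha> g a" "\<alpha> g b"] translate_in[OF that(1) K(2)]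
        action_mult[OF that(1)] subgroup.mem_carrier[OF sK] that by simp
    have \<theta>_one: "\<theta> \<one>\<^bsub>N\<^esub> = \<one>\<^bsub>Q\<^esub>"
      using word_eval_subgroup_hom[OF N.is_group Q subgroup_halo[OF gK[OF H.one_closed]]
          \<theta>[OF H.one_closed], of "[]"] by simp
    have trace_closed: "\<theta> ` set (trace f g w) \<subseteq> carrier Q" if "g \<in> carrier H" "w \<in> lists X" for g w
    proof -
      have "fst (f x) \<in> carrier (L K)" if "x \<in> X" for x using EK that by (auto simp: E_def)
      then show ?thesis using trace_in[OF f that] \<theta>_closed by blast
    qed
    have \<Theta>_closed: "\<Theta> g w \<in> carrier Q" if "g \<in> carrier H" "w \<in> lists X" for g w
      unfolding \<Theta>_def using trace_closed[OF that] by (rule Q.word_eval_closed)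
    have \<Theta>_append: "\<Theta> g (u @ v) = \<Theta> g u \<otimes>\<^bsub>Q\<^esub> \<Theta> (g \<otimes> snd (word_eval P f u)) v"
      if "g \<in> carrier H" "u \<in> lists X" "v \<in> lists X" for g u v
      unfolding \<Theta>_def trace_append[OF f that(1,2)]
      using trace_closed[OF that(1,2)] trace_closed[OF H.m_closed[OF that(1) eval_in(3)[OF f that(2)]] that(3)]
      by (rule Q.word_eval_append)
    have eval_append: "word_eval P f (u @ v) = word_eval P f u \<otimes>\<^bsub>P\<^esub> word_eval P f v"
      if "u \<in> lists X" "v \<in> lists X" for u v
      using that f by (intro P.word_eval_append) auto
    have local_eval: "\<Theta> g w = \<theta> (\<alpha> g (fst (word_eval P f w)))"
      if g: "g \<in> carrier H" and w: "w \<in> W" for g w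
    proof -
      have wX: "w \<in> lists X" using w W by blast
      have "set (trace f \<one> w) \<subseteq> carrier (L K)" using EK w by (auto simp: E_def)
      then have "set (trace f g w) \<subseteq> carrier (L (g <# K))"
        using trace_translate[OF f g H.one_closed wX] translate_in[OF g K(2)] g by auto
      then show ?thesis
        using word_eval_subgroup_hom[OF N.is_group Q subgroup_halo[OF gK[OF g]] \<theta>[OF g]]
          eval_trace[OF f g wX] by (simp add: \<Theta>_def)
    qed
    have invariant: "word_eval P f u = word_eval P f v \<and> (\<forall>g\<in>carrier H. \<Theta> g u = \<Theta> g v)"
      if "word_cong X R u v" for u v
      using that
    proof (induction rule: word_cong.induct)
      case (word_rule u v)
      have "u \<in> fst ` R" "v \<in> snd ` R" using word_rule(1) by force+
      then have "u \<in> W" "v \<in> W" by (auto simp: W_def)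
      then show ?case using R_eval[OF word_rule(1)] local_eval by simp
    next
      case (word_append u u' v v')
      have "u \<in> lists X" "u' \<in> lists X" "v \<in> lists X" "v' \<in> lists X"
        using word_append word_cong_lists by blast+
      then show ?case
        using word_append \<Theta>_append eval_append H.m_closed eval_in(3)[OF f] by metis
    qed simp_all
    \<comment> \<open>There may be infinitely many elements \<open>(1, h)\<close>, too many for a finite \<open>K\<close> to support the traces
      of words chosen for all of them. Composing words for the images in \<open>H\<close> of single letters gives a
      word for \<open>(1, h)\<close> whose trace still evaluates to \<open>\<one>\<close>.\<close>
    have units: "\<exists>w\<in>lists X. word_eval P f w = (\<one>\<^bsub>N\<^esub>, snd (word_eval P f v)) \<and>
        (\<forall>g\<in>carrier H. \<Theta> g w = \<one>\<^bsub>Q\<^esub>)" if "v \<in> lists X" for v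
      using that
    proof (induction v)
      case Nil
      then show ?case by (intro bexI[of _ "[]"]) (auto simp: P_simps \<Theta>_def)
    next
      case (Cons x v)
      then obtain w where w: "w \<in> lists X" "word_eval P f w = (\<one>\<^bsub>N\<^esub>, snd (word_eval P f v))"
        "\<forall>g\<in>carrier H. \<Theta> g w = \<one>\<^bsub>Q\<^esub>" by blast
      let ?p = "(\<one>\<^bsub>N\<^esub>, snd (f x))"
      have x: "x \<in> X" and v: "v \<in> lists X" using Cons by auto
      have p: "?p \<in> D" "?p \<in> carrier P" using x D by (auto simp: D_def)
      have wp: "wd ?p \<in> W" using p by (auto simp: W_def)
      have "word_eval P f (wd ?p @ w) = (\<one>\<^bsub>N\<^esub>, snd (word_eval P f (x # v)))"
        using eval_append[OF wd(1)[OF p(2)] w(1)] wd(2)[OF p(2)] w(2) fx[OF x]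
        by (simp add: P_mult action_unit)
      moreover have "\<Theta> g (wd ?p @ w) = \<one>\<^bsub>Q\<^esub>" if g: "g \<in> carrier H" for g
        using \<Theta>_append[OF g wd(1)[OF p(2)] w(1)] local_eval[OF g wp] wd(2)[OF p(2)] w(3) fx[OF x] g
        by (simp add: action_unit \<theta>_one)
      ultimately show ?case using wd(1)[OF p(2)] w(1)
        by (intro bexI[of _ "wd ?p @ w"]) auto
    qed
    have generated: "a \<in> carrier (L K) \<and> (\<exists>w\<in>lists X. word_eval P f w = (a, \<one>) \<and>
        (\<forall>g\<in>carrier H. \<Theta> g w = \<theta> (\<alpha> g a)))" if "a \<in> generate N F" for a
      using that
    proof (induction rule: generate.induct)
      case one
      then show ?case using subgroup.one_closed[OF sK]
        by (intro conjI bexI[of _ "[]"]) (auto simp: P_simps \<Theta>_def action_unit \<theta>_one)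
    next
      case (incl a)
      have "(a, \<one>) \<in> D" using incl by (auto simp: D_def)
      moreover from this have "(a, \<one>) \<in> carrier P" "wd (a, \<one>) \<in> W" using D by (auto simp: W_def)
      ultimately show ?case using incl FK wd[of "(a, \<one>)"] local_eval
        by (intro conjI bexI[of _ "wd (a, \<one>)"]) auto
    next
      case (inv a)
      have "(inv\<^bsub>N\<^esub> a, \<one>) \<in> D" using inv by (auto simp: D_def)
      moreover from this have "(inv\<^bsub>N\<^esub> a, \<one>) \<in> carrier P" "wd (inv\<^bsub>N\<^esub> a, \<one>) \<in> W"
        using D by (auto simp: W_def)
      moreover have "inv\<^bsub>N\<^esub> a \<in> carrier (L K)"
        using inv FK subgroup.m_inv_closed[OF sK] by blast
      ultimately show ?case using wd[of "(inv\<^bsub>N\<^esub> a, \<one>)"] local_eval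
        by (intro conjI bexI[of _ "wd (inv\<^bsub>N\<^esub> a, \<one>)"]) auto
    next
      case (eng a b)
      then obtain u v where u: "u \<in> lists X" "word_eval P f u = (a, \<one>)"
          "\<forall>g\<in>carrier H. \<Theta> g u = \<theta> (\<alpha> g a)"
        and v: "v \<in> lists X" "word_eval P f v = (b, \<one>)"
          "\<forall>g\<in>carrier H. \<Theta> g v = \<theta> (\<alpha> g b)"
        and ab: "a \<in> carrier (L K)" "b \<in> carrier (L K)" by blast
      have "b \<in> carrier N" using ab subgroup.mem_carrier[OF sK] by blast
      then have "word_eval P f (u @ v) = (a \<otimes>\<^bsub>N\<^esub> b, \<one>)"
        using eval_append[OF u(1) v(1)] u(2) v(2) by (simp add: P_mult action_one)
      moreover have "\<Theta> g (u @ v) = \<theta> (\<alpha> g (a \<otimes>\<^bsub>N\<^esub> b))" if g: "g \<in> carrier H" for g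
        using \<Theta>_append[OF g u(1) v(1)] u v g \<theta>_mult[OF g ab] by simp
      moreover have "a \<otimes>\<^bsub>N\<^esub> b \<in> carrier (L K)" using subgroup.m_closed[OF sK ab] .
      ultimately show ?case using u(1) v(1) by (intro conjI bexI[of _ "u @ v"]) auto
    qed
    \<comment> \<open>The word for the translate of \<open>a\<close> by \<open>h\<close> walks to \<open>h\<close>, spells \<open>a\<close> there and walks back.\<close>
    have translates: "\<exists>w\<in>lists X. word_eval P f w = (\<alpha> h a, \<one>) \<and> \<Theta> \<one> w = \<theta> (\<alpha> h a)"
      if h: "h \<in> carrier H" and a: "a \<in> generate N F" for h a
    proof -
      have hP: "(\<one>\<^bsub>N\<^esub>, h) \<in> carrier P" "(\<one>\<^bsub>N\<^esub>, inv h) \<in> carrier P"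
        using h by (simp_all add: P_simps)
      obtain u where u: "u \<in> lists X" "word_eval P f u = (\<one>\<^bsub>N\<^esub>, h)"
        "\<forall>g\<in>carrier H. \<Theta> g u = \<one>\<^bsub>Q\<^esub>"
        using surj[OF hP(1)] units by (metis snd_conv)
      obtain v where v: "v \<in> lists X" "word_eval P f v = (\<one>\<^bsub>N\<^esub>, inv h)"
        "\<forall>g\<in>carrier H. \<Theta> g v = \<one>\<^bsub>Q\<^esub>"
        using surj[OF hP(2)] units by (metis snd_conv)
      obtain w where w: "w \<in> lists X" "word_eval P f w = (a, \<one>)"
        "\<forall>g\<in>carrier H. \<Theta> g w = \<theta> (\<alpha> g a)" and aK: "a \<in> carrier (L K)"
        using generated[OF a] by blast
      have aN: "a \<in> carrier N" using aK by (rule subgroup.mem_carrier[OF sK])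
      have wv: "w @ v \<in> lists X" using w v by simp
      have "word_eval P f (u @ w @ v) = (\<alpha> h a, \<one>)"
        using eval_append[OF u(1) wv] eval_append[OF w(1) v(1)] u(2) v(2) w(2) h aN
        by (simp add: P_mult action_one action_closed)
      moreover have "\<Theta> \<one> (u @ w @ v) = \<theta> (\<alpha> h a)"
        using \<Theta>_append[OF _ u(1) wv] \<Theta>_append[OF _ w(1) v(1)] u v w h \<theta>_closed[OF h aK]
        by simp
      ultimately show ?thesis using u(1) wv by (intro bexI[of _ "u @ w @ v"]) auto
    qed
    have "\<exists>w\<in>lists X. word_eval P f w = (word_eval N (\<lambda>x. x) ys, \<one>) \<and> \<Theta> \<one> w = word_eval Q \<theta> ys \<and>
        word_eval N (\<lambda>x. x) ys \<in> carrier N"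
      using ys
    proof (induction ys)
      case Nil
      then show ?case by (intro bexI[of _ "[]"]) (auto simp: P_simps \<Theta>_def)
    next
      case (Cons y ys)
      then obtain v where v: "v \<in> lists X" "word_eval P f v = (word_eval N (\<lambda>x. x) ys, \<one>)"
        "\<Theta> \<one> v = word_eval Q \<theta> ys" "word_eval N (\<lambda>x. x) ys \<in> carrier N" by auto
      obtain h a where ha: "y = \<alpha> h a" "h \<in> carrier H" "a \<in> generate N F" using Cons.prems by auto
      then obtain u where u: "u \<in> lists X" "word_eval P f u = (y, \<one>)" "\<Theta> \<one> u = \<theta> y"
        using translates by blast
      have "y \<in> carrier N" using eval_in(2)[OF f u(1)] u(2) by simp
      then show ?case
        using eval_append[OF u(1) v(1)] \<Theta>_append[OF H.one_closed u(1) v(1)] u v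
        by (intro bexI[of _ "u @ v"]) (auto simp: P_mult action_one)
    qed
    then obtain w where w: "w \<in> lists X" "word_eval P f w = (\<one>\<^bsub>N\<^esub>, \<one>)" "\<Theta> \<one> w = word_eval Q \<theta> ys"
      using ys1 by auto
    have "word_cong X R w []" using complete[OF w(1)] w(2) by (simp add: P_simps)
    then have "\<Theta> \<one> w = \<Theta> \<one> []" using invariant by blast
    then show "word_eval Q \<theta> ys = \<one>\<^bsub>Q\<^esub>" using w(3) by (simp add: \<Theta>_def)
  qed
qed

end

section \<open>Cutting the halo far from a finite set\<close>

context halo_action
begin

lemma generate_translates:
  assumes h: "h \<in> carrier H" and F: "F \<subseteq> carrier N"
    and S: "S \<subseteq> (\<lambda>a. (\<alpha> h a, \<one>)) ` generate N F"
  shows "generate P S \<subseteq> (\<lambda>a. (\<alpha> h a, \<one>)) ` generate N F"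
proof -
  interpret \<iota>: group_hom N P "\<lambda>a. (\<alpha> h a, \<one>)"
    using h by unfold_locales
      (auto simp: hom_def P_simps action_closed action_mult action_one)
  show ?thesis
    using S by (rule P.generate_subgroup_incl)
      (rule \<iota>.subgroup_img_is_subgroup[OF N.generate_is_subgroup[OF F]])
qed

lemma conj_set_eq:
  assumes h: "h \<in> carrier H" and F: "F \<subseteq> carrier N \<times> {\<one>}"
  shows "conj_set P (\<one>\<^bsub>N\<^esub>, h) F = (\<lambda>a. (\<alpha> h a, \<one>)) ` fst ` F"
proof -
  have inv: "inv\<^bsub>P\<^esub> (\<one>\<^bsub>N\<^esub>, h) = (\<one>\<^bsub>N\<^esub>, inv h)"
    using h by (intro P.inv_equality) (auto simp: P_simps action_unit)
  have "(\<one>\<^bsub>N\<^esub>, h) \<otimes>\<^bsub>P\<^esub> p \<otimes>\<^bsub>P\<^esub> inv\<^bsub>P\<^esub> (\<one>\<^bsub>N\<^esub>, h) = (\<alpha> h (fst p), \<one>)" if "p \<in> F" for p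
    using that F h by (auto simp: inv P_simps action_unit action_closed)
  then show ?thesis unfolding conj_set_def by (simp add: image_image cong: image_cong)
qed

lemma eval_kernel_word:
  assumes "\<And>x. x \<in> set w \<Longrightarrow> f x \<in> carrier N \<times> {\<one>}"
  shows "word_eval P f w = (word_eval N (\<lambda>x. x) (map (fst \<circ> f) w), \<one>) \<and>
    word_eval N (\<lambda>x. x) (map (fst \<circ> f) w) \<in> carrier N"
  using assms
proof (induction w)
  case Nil
  then show ?case by (simp add: P_simps)
next
  case (Cons x w)
  then have "f x \<in> carrier N \<times> {\<one>}" by simp
  then obtain a where "f x = (a, \<one>)" "a \<in> carrier N" by blast
  with Cons show ?case by (simp add: P_mult action_one)
qed

text \<open>The exceptional \<open>h\<close> are among those for which \<open>hK\<close> meets \<open>U\<close>, the union of the translates of \<open>K\<close> that meet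
\<open>K\<close>. The cut into \<open>U\<close> and \<open>V\<close> depends only on \<open>K\<close>, so one amalgam serves for all the other \<open>h\<close>.\<close>

lemma finite_not_free_product:
  assumes fp: "finitely_presented P" and F: "finite F" "F \<subseteq> carrier N \<times> {\<one>}"
  shows "finite {h \<in> carrier H. \<not> inj_on (natural_morphism P)
    (carrier (subgroup_free_product P (generate P F) (generate P (conj_set P (\<one>\<^bsub>N\<^esub>, h) F))))}"
proof -
  have F': "finite (fst ` F)" "fst ` F \<subseteq> carrier N" using F by auto
  obtain K where K: "finite K" "K \<subseteq> carrier H" "K \<noteq> {}" "fst ` F \<subseteq> carrier (L K)"
    and rel: "\<And>(Q :: ('l \<times> 'l list \<Rightarrow> 'l \<times> 'l list) monoid) \<theta> ys. group Q \<Longrightarrow>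
      (\<And>g. g \<in> carrier H \<Longrightarrow> \<theta> \<in> hom (N\<lparr>carrier := carrier (L (g <# K))\<rparr>) Q) \<Longrightarrow>
      set ys \<subseteq> {\<alpha> g a | g a. g \<in> carrier H \<and> a \<in> generate N (fst ` F)} \<Longrightarrow>
      word_eval N (\<lambda>x. x) ys = \<one>\<^bsub>N\<^esub> \<Longrightarrow> word_eval Q \<theta> ys = \<one>\<^bsub>Q\<^esub>"
    using finitely_presented_local_relations[OF fp F', where ?'q = "'l \<times> 'l list \<Rightarrow> 'l \<times> 'l list"]
    by blast
  define I where "I = {g \<in> carrier H. (g <# K) \<inter> K \<noteq> {}}"
  define U where "U = (\<Union>g\<in>I. g <# K)"
  define V where "V = (\<Union>g\<in>carrier H - I. g <# K)"
  have gK: "g <# K \<subseteq> carrier H" if "g \<in> carrier H" for g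
    using that K(2) by (rule H.l_coset_subset_G[rotated])
  have UV: "U \<subseteq> carrier H" "V \<subseteq> carrier H" using gK by (auto simp: U_def V_def I_def)
  have one_K: "\<one> <# K = K" using K(2) by (rule H.lcos_mult_one)
  have KU: "K \<subseteq> U" using K(3) one_K unfolding U_def I_def by force
  have KV: "K \<inter> V = {}" by (auto simp: V_def I_def)
  have "finite I" unfolding I_def using K by (intro H.finite_translates_meeting) auto
  then have finU: "finite U" using K(1) by (simp add: U_def l_coset_def)
  obtain Q :: "('l \<times> 'l list \<Rightarrow> 'l \<times> 'l list) monoid" and \<theta> where Q: "group Q"
    and \<theta>U: "\<theta> \<in> hom (N\<lparr>carrier := carrier (L U)\<rparr>) Q"
    and \<theta>V: "\<theta> \<in> hom (N\<lparr>carrier := carrier (L V)\<rparr>) Q"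
    and alt: "\<And>ys. alternating (carrier (L U)) (carrier (L V)) ys \<Longrightarrow> ys \<noteq> [] \<Longrightarrow>
      word_eval Q \<theta> ys \<noteq> \<one>\<^bsub>Q\<^esub>"
    using amalgam_alternating[OF N.is_group subgroup_halo[OF UV(1)] subgroup_halo[OF UV(2)]] by metis
  have \<theta>: "\<theta> \<in> hom (N\<lparr>carrier := carrier (L (g <# K))\<rparr>) Q" if g: "g \<in> carrier H" for g
  proof (cases "g \<in> I")
    case True
    then have "carrier (L (g <# K)) \<subseteq> carrier (L U)"
      by (intro halo_carrier_mono UV) (auto simp: U_def)
    then show ?thesis using \<theta>U by (auto simp: hom_def)
  next
    case False
    then have "carrier (L (g <# K)) \<subseteq> carrier (L V)"
      using g by (intro halo_carrier_mono UV) (auto simp: V_def)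
    then show ?thesis using \<theta>V by (auto simp: hom_def)
  qed
  have FK: "generate N (fst ` F) \<subseteq> carrier (L K)"
    by (rule N.generate_subgroup_incl[OF K(4) subgroup_halo[OF K(2)]])
  have FN: "generate N (fst ` F) \<subseteq> carrier N"
    using F'(2) by (rule N.generate_incl)
  have inj: "inj_on (natural_morphism P)
      (carrier (subgroup_free_product P (generate P F) (generate P (conj_set P (\<one>\<^bsub>N\<^esub>, h) F))))"
    if h: "h \<in> carrier H" and far: "(h <# K) \<inter> U = {}" for h
  proof -
    let ?A = "generate P F" and ?B = "generate P (conj_set P (\<one>\<^bsub>N\<^esub>, h) F)"
    have "h \<notin> I" using far K(3) by (auto simp: U_def l_coset_def)
    then have hV: "h <# K \<subseteq> V" using h by (auto simp: V_def)
    have cF: "conj_set P (\<one>\<^bsub>N\<^esub>, h) F \<subseteq> (\<lambda>a. (\<alpha> h a, \<one>)) ` generate N (fst ` F)"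
      unfolding conj_set_eq[OF h F(2)] by (auto intro: generate.incl)
    have "F \<subseteq> (\<lambda>a. (\<alpha> \<one> a, \<one>)) ` generate N (fst ` F)"
    proof
      fix p assume p: "p \<in> F"
      then have "fst p \<in> generate N (fst ` F)" by (blast intro: generate.incl)
      moreover have "p = (\<alpha> \<one> (fst p), \<one>)" using p F(2) by (auto simp: action_one)
      ultimately show "p \<in> (\<lambda>a. (\<alpha> \<one> a, \<one>)) ` generate N (fst ` F)" by blast
    qed
    from generate_translates[OF H.one_closed F'(2) this]
    have A: "?A \<subseteq> (\<lambda>a. (\<alpha> \<one> a, \<one>)) ` generate N (fst ` F)" .
    have B: "?B \<subseteq> (\<lambda>a. (\<alpha> h a, \<one>)) ` generate N (fst ` F)"
      by (rule generate_translates[OF h F'(2) cF])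
    have imP: "(\<lambda>a. (\<alpha> k a, \<one>)) ` generate N (fst ` F) \<subseteq> carrier P" if "k \<in> carrier H" for k
      using FN action_closed[OF that] by (auto simp: P_simps)
    have subA: "subgroup ?A P"
      using F(2) by (intro P.generate_is_subgroup) (auto simp: P_simps)
    have subB: "subgroup ?B P"
      using cF imP[OF h] by (intro P.generate_is_subgroup) blast
    show ?thesis
    proof (rule P.natural_morphism_inj[OF subA subB])
      fix w assume w: "w \<in> lists (?A <+> ?B)" and red: "reduced P w"
        and eval: "word_eval P (case_sum id id) w = \<one>\<^bsub>P\<^esub>"
      let ?f = "case_sum id id :: 'l \<times> 'h + 'l \<times> 'h \<Rightarrow> 'l \<times> 'h"
      \<comment> \<open>A letter of \<open>w\<close> is an element of \<open>\<langle>F\<rangle>\<close> translated by \<open>\<one>\<close> or by \<open>h\<close>, according to its factor.\<close>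
      define pos where "pos x = (if isl x then \<one> else h)" for x :: "'l \<times> 'h + 'l \<times> 'h"
      have pos: "pos x \<in> carrier H" for x using h by (simp add: pos_def)
      have letter: "?f x \<in> (\<lambda>a. (\<alpha> (pos x) a, \<one>)) ` generate N (fst ` F)" if "x \<in> set w" for x
      proof -
        have "x \<in> ?A <+> ?B" using w that by blast
        then show ?thesis using A B by (cases x) (auto simp: pos_def)
      qed
      have kernel: "?f x \<in> carrier N \<times> {\<one>}" if x: "x \<in> set w" for x
      proof -
        obtain a where "?f x = (\<alpha> (pos x) a, \<one>)" "a \<in> generate N (fst ` F)"
          using letter[OF x] by blast
        then show ?thesis using subsetD[OF FN] action_closed[OF pos] by simp
      qed
      have nontrivial: "fst (?f x) \<noteq> \<one>\<^bsub>N\<^esub>" if "x \<in> set w" for x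
        using red kernel[OF that] that by (auto simp: reduced_def P_simps prod_eq_iff)
      have side: "(fst (?f x) \<in> carrier (L U) \<longleftrightarrow> isl x) \<and> (fst (?f x) \<in> carrier (L V) \<longleftrightarrow> \<not> isl x)"
        if x: "x \<in> set w" for x
      proof -
        obtain a where a: "?f x = (\<alpha> (pos x) a, \<one>)" "a \<in> generate N (fst ` F)"
          using letter[OF x] by blast
        then have y: "fst (?f x) \<in> carrier (L (pos x <# K))"
          using translate_in[OF pos K(2) subsetD[OF FK a(2)]] by simp
        show ?thesis
        proof (cases "isl x")
          case True
          then have "fst (?f x) \<in> carrier (L K)" using y one_K by (simp add: pos_def)
          then show ?thesis
            using halo_disjoint[OF K(2) UV(2) KV] halo_carrier_mono[OF KU UV(1)]
              nontrivial[OF x] True by blast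
        next
          case False
          then have "fst (?f x) \<in> carrier (L (h <# K))" using y by (simp add: pos_def)
          then show ?thesis
            using halo_disjoint[OF gK[OF h] UV(1) far] halo_carrier_mono[OF hV UV(2)]
              nontrivial[OF x] False by blast
        qed
      qed
      let ?ys = "map (fst \<circ> ?f) w"
      have "successively (\<lambda>x y. isl x \<noteq> isl y) w" using red by (simp add: reduced_def)
      then have "successively (\<lambda>x y. fst (?f x) \<in> carrier (L U) \<longleftrightarrow> fst (?f y) \<notin> carrier (L U)) w"
        by (rule successively_mono) (use side in blast)
      then have ys_alt: "alternating (carrier (L U)) (carrier (L V)) ?ys"
        using side by (auto simp: alternating_def successively_map)
      have "set ?ys \<subseteq> {\<alpha> g a | g a. g \<in> carrier H \<and> a \<in> generate N (fst ` F)}"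
      proof
        fix y assume "y \<in> set ?ys"
        then obtain x where x: "x \<in> set w" "y = fst (?f x)" by auto
        then have "y \<in> \<alpha> (pos x) ` generate N (fst ` F)" using letter[OF x(1)] by force
        then show "y \<in> {\<alpha> g a | g a. g \<in> carrier H \<and> a \<in> generate N (fst ` F)}"
          using pos by blast
      qed
      moreover have "word_eval N (\<lambda>x. x) ?ys = \<one>\<^bsub>N\<^esub>"
        using eval eval_kernel_word[of w ?f] kernel by (simp add: P_simps)
      ultimately have "word_eval Q \<theta> ?ys = \<one>\<^bsub>Q\<^esub>"
        using rel[OF Q \<theta>] by blast
      then show "w = []" using alt[OF ys_alt] by auto
    qed
  qed
  show ?thesis
  proof (rule finite_subset)
    show "finite {h \<in> carrier H. (h <# K) \<inter> U \<noteq> {}}"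
      using K finU UV by (intro H.finite_translates_meeting)
  qed (use inj in blast)
qed

end

theorem theorem1p5:
  fixes H :: "('h, 'm) monoid_scheme"
    and L :: "'h set \<Rightarrow> ('l, 'n) monoid_scheme"
    and \<alpha> :: "'h \<Rightarrow> 'l \<Rightarrow> 'l"
  defines "P \<equiv> halo_product H L \<alpha>"
  assumes "halo_action H L \<alpha>"
    and "\<exists>F. finite F \<and> F \<subseteq> carrier (L (carrier H)) \<times> {\<one>\<^bsub>H\<^esub>} \<and>
      infinite {h \<in> carrier H.
        \<not> inj_on (natural_morphism P)
          (carrier (subgroup_free_product P (generate P F)
            (generate P (conj_set P (\<one>\<^bsub>L (carrier H)\<^esub>, h) F))))}"
  shows "\<not> finitely_presented P"
  using assms(3) halo_action.finite_not_free_product[OF assms(2)] unfolding P_def by blast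

end
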